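(* Let $(A,\circ)$ be a left-symmetric algebra over a field $\Bbbk$. Then $(A,\circ)$ embeds into a differential Perm-algebra $(P,d)$ in such a way that $a\circ b=a\,d(b)$ for all $a,b\in A$ if and only if $A$ is a nice SLS-algebra.
   Context: $\Bbbk$ is an arbitrary field. A left-symmetric algebra is a linear space with a bilinear operation $\circ$ satisfying $(a,b,c)=(b,a,c)$, where $(a,b,c)=(a\circ b)\circ c-a\circ(b\circ c)$. An SLS-algebra is a left-symmetric algebra satisfying in addition the identities $((x\circ y)\circ z)\circ u=((x\circ z)\circ y)\circ u$ and $(x,y\circ z,u)=(y,x\circ z,u)$. An SLS-algebra $(A,\circ)$ is nice if for every $x\in A$ there exists a linear map $\mu_x:A\circ A\to A$ such that $\mu_x(a\circ b)=(a\circ x)\circ b$ for all $a,b\in A$, where $A\circ A$ is the linear span of all products $a\circ b$, $a,b\in A$. A Perm-algebra is an associative (not necessarily unital) algebra satisfying $xyz=yxz$. A differential Perm-algebra is a pair $(P,d)$ with $P$ a Perm-algebra and $d$ a derivation of $P$. An embedding of $(A,\circ)$ into $(P,d)$ with $a\circ b=a\,d(b)$ means an injective linear map $\theta:A\to P$ with $\theta(a\circ b)=\theta(a)d(\theta(b))$ for all $a,b\in A$. *)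

theory Defs
  imports Complex_Main "HOL-Library.Poly_Mapping"
begin

locale bilinear_algebra = vector_space scale
  for scale :: "'k::field \<Rightarrow> 'a::ab_group_add \<Rightarrow> 'a" +
  fixes mult :: "'a \<Rightarrow> 'a \<Rightarrow> 'a" (infixl "\<odot>" 70)
  assumes linear_left: "\<And>b. Vector_Spaces.linear scale scale (\<lambda>a. a \<odot> b)"
    and linear_right: "\<And>a. Vector_Spaces.linear scale scale (\<lambda>b. a \<odot> b)"
begin

definition associator :: "'a \<Rightarrow> 'a \<Rightarrow> 'a \<Rightarrow> 'a"
  where "associator a b c = (a \<odot> b) \<odot> c - a \<odot> (b \<odot> c)"

definition product_space :: "'a set"
  where "product_space = span {a \<odot> b | a b. True}"

text \<open>
  Linearity of the map \<open>\<mu>\<close> from \<open>product_space\<close> to the algebra is required on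
  \<open>product_space\<close> only; the values of \<open>\<mu>\<close> elsewhere are irrelevant.
\<close>
definition nice :: bool
  where "nice \<longleftrightarrow>
    (\<forall>x. \<exists>\<mu>.
      (\<forall>u\<in>product_space. \<forall>v\<in>product_space. \<mu> (u + v) = \<mu> u + \<mu> v) \<and>
      (\<forall>c. \<forall>u\<in>product_space. \<mu> (scale c u) = scale c (\<mu> u)) \<and>
      (\<forall>a b. \<mu> (a \<odot> b) = (a \<odot> x) \<odot> b))"

end

locale left_symmetric_algebra = bilinear_algebra scale mult
  for scale :: "'k::field \<Rightarrow> 'a::ab_group_add \<Rightarrow> 'a" and mult (infixl "\<odot>" 70) +
  assumes left_symmetric: "\<And>a b c. associator a b c = associator b a c"

locale SLS_algebra = left_symmetric_algebra scale mult
  for scale :: "'k::field \<Rightarrow> 'a::ab_group_add \<Rightarrow> 'a" and mult (infixl "\<odot>" 70) +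
  assumes right_commutative_left: "\<And>x y z u. ((x \<odot> y) \<odot> z) \<odot> u = ((x \<odot> z) \<odot> y) \<odot> u"
    and associator_exchange: "\<And>x y z u. associator x (y \<odot> z) u = associator y (x \<odot> z) u"

locale nice_SLS_algebra = SLS_algebra scale mult
  for scale :: "'k::field \<Rightarrow> 'a::ab_group_add \<Rightarrow> 'a" and mult (infixl "\<odot>" 70) +
  assumes nice: "nice"

locale perm_algebra = bilinear_algebra scale mult
  for scale :: "'k::field \<Rightarrow> 'a::ab_group_add \<Rightarrow> 'a" and mult (infixl "\<odot>" 70) +
  assumes associative: "\<And>x y z. (x \<odot> y) \<odot> z = x \<odot> (y \<odot> z)"
    and perm: "\<And>x y z. (x \<odot> y) \<odot> z = (y \<odot> x) \<odot> z"

locale differential_perm_algebra = perm_algebra scale mult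
  for scale :: "'k::field \<Rightarrow> 'a::ab_group_add \<Rightarrow> 'a" and mult (infixl "\<odot>" 70) +
  fixes d :: "'a \<Rightarrow> 'a"
  assumes linear_derivation: "Vector_Spaces.linear scale scale d"
    and leibniz: "\<And>x y. d (x \<odot> y) = d x \<odot> y + x \<odot> d y"

definition is_differential_embedding ::
  "('k::field \<Rightarrow> 'a::ab_group_add \<Rightarrow> 'a) \<Rightarrow> ('a \<Rightarrow> 'a \<Rightarrow> 'a) \<Rightarrow>
   ('k \<Rightarrow> 'p::ab_group_add \<Rightarrow> 'p) \<Rightarrow> ('p \<Rightarrow> 'p \<Rightarrow> 'p) \<Rightarrow> ('p \<Rightarrow> 'p) \<Rightarrow> ('a \<Rightarrow> 'p) \<Rightarrow> bool"
  where "is_differential_embedding scale mult scaleP multP d \<theta> \<longleftrightarrow>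
    Vector_Spaces.linear scale scaleP \<theta> \<and> inj \<theta> \<and>
    (\<forall>a b. \<theta> (mult a b) = multP (\<theta> a) (d (\<theta> b)))"

text \<open>
  HOL cannot quantify existentially over types, so the type carrying the differential
  Perm-algebra is a parameter. Only its additive group is given; the scalar multiplication,
  the product and the derivation are existentially quantified.
\<close>
definition embeds_in_differential_perm_algebra ::
  "'p::ab_group_add itself \<Rightarrow>
   ('k::field \<Rightarrow> 'a::ab_group_add \<Rightarrow> 'a) \<Rightarrow> ('a \<Rightarrow> 'a \<Rightarrow> 'a) \<Rightarrow> bool"
  where "embeds_in_differential_perm_algebra (_ :: 'p itself) scale mult \<longleftrightarrow>
    (\<exists>(scaleP :: 'k \<Rightarrow> 'p \<Rightarrow> 'p) multP d \<theta>.
      differential_perm_algebra scaleP multP d \<and>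
      is_differential_embedding scale mult scaleP multP d \<theta>)"

text \<open>
  A carrier type that suffices for every left-symmetric algebra on \<open>'a\<close> over \<open>'k\<close>: a
  differential Perm-algebra containing a copy of \<open>'a\<close> may be replaced by its differential
  subalgebra generated by that copy, which is spanned by products of iterated derivatives of
  elements of \<open>'a\<close>. Such products are indexed by lists of pairs (element, order of
  derivative), so the subalgebra is, as a vector space, a direct summand of the finitely
  supported functions from these lists to \<open>'k\<close>; the complement may be given zero product
  and zero derivation.
\<close>
type_synonym ('a, 'k) perm_carrier = "('a \<times> nat) list \<Rightarrow>\<^sub>0 'k"

end

theory Submission
  imports Defs "HOL-Library.Function_Algebras" "HOL-Library.Multiset"
begin

text \<open>
  In a differential Perm-algebra with \<open>a \<odot> b = a d(b)\<close>, give \<open>a\<^sup>(\<^sup>n\<^sup>) = d\<^sup>n(a)\<close> the weight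
  \<open>n - 1\<close>; the product \<open>\<odot>\<close> lives in weight \<open>-1\<close>. For the universal such algebra the point is
  to construct a linear map \<open>W\<close> from words to \<open>A\<close> that respects all defining relations and maps
  the letter \<open>a\<close> to \<open>a\<close>; then \<open>A\<close> injects into the quotient of the free algebra.

  An element of weight \<open>n - 1\<close> is encoded by the symmetric multilinear function obtained by
  multiplying it with \<open>n\<close> elements of \<open>A\<close>, which brings it down to weight \<open>-1\<close>. On such functions
  multiplication by \<open>a\<close> is partial evaluation, multiplication by \<open>d(a)\<close> is the map
  \<open>\<rho>\<^sub>a\<close> supplied by niceness, and \<open>d\<close> is forced by the Leibniz rule. Multiplication by
  \<open>d\<^sup>n(a)\<close> is then an iterated commutator with \<open>d\<close>. Differentiating \<open>a d(c) = a \<odot> c\<close> gives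
  \<open>\<Sum>\<^sub>i (n choose i) a\<^sup>(\<^sup>i\<^sup>) c\<^sup>(\<^sup>n\<^sup>+\<^sup>1\<^sup>-\<^sup>i\<^sup>) = (a \<odot> c)\<^sup>(\<^sup>n\<^sup>)\<close>, which expresses \<open>a c\<^sup>(\<^sup>n\<^sup>+\<^sup>1\<^sup>)\<close> by
  derivatives of lower order and so yields by induction that all these operators commute.

  Conversely, \<open>\<mu>\<^sub>x\<close> is the product with \<open>d(x)\<close>, which preserves the image of \<open>A \<odot> A\<close>.
\<close>

text \<open>
  The sum of \<open>(n choose i) f i (n + 1 - i)\<close> over \<open>i \<le> n\<close>, in the form produced by applying the
  Leibniz rule \<open>n\<close> times to the product with orders 0 and 1.
\<close>
fun leib :: "nat \<Rightarrow> (nat \<Rightarrow> nat \<Rightarrow> 'b::ab_group_add) \<Rightarrow> 'b" where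
  "leib 0 f = f 0 1"
| "leib (Suc n) f = leib n (\<lambda>i j. f (Suc i) j + f i (Suc j))"

text \<open>The recursion starts from the orders (0, 1) and only raises them, so
  \<open>leib n\<close> sees only pairs of total order n + 1 whose second order is positive.\<close>

lemma leib_cong:
  assumes "\<And>i j. i + j = Suc n \<Longrightarrow> 0 < j \<Longrightarrow> f i j = f' i j"
  shows "leib n f = leib n f'"
  using assms
proof (induction n arbitrary: f f')
  case (Suc n)
  show ?case
    unfolding leib.simps by (rule Suc.IH) (simp add: Suc.prems)
qed simp

lemma leib_additive:
  assumes "\<And>x y. h (x + y) = h x + h y"
  shows "h (leib n f) = leib n (\<lambda>i j. h (f i j))"
  by (induction n arbitrary: f) (simp_all add: assms)

lemma leib_diff: "leib n f - leib n f' = leib n (\<lambda>i j. f i j - f' i j)"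
proof (induction n arbitrary: f f')
  case (Suc n)
  have "leib (Suc n) f - leib (Suc n) f' =
      leib n (\<lambda>i j. (f (Suc i) j + f i (Suc j)) - (f' (Suc i) j + f' i (Suc j)))"
    by (simp add: Suc)
  also have "\<dots> = leib (Suc n) (\<lambda>i j. f i j - f' i j)"
    by (simp add: algebra_simps)
  finally show ?case .
qed simp

text \<open>The pair (0, n + 1) has binomial coefficient 1. Once the mixed terms vanish, the
  boundary term is isolated without division, whatever the characteristic.\<close>

lemma leib_boundary:
  assumes "\<And>i j. i + j = Suc n \<Longrightarrow> 0 < i \<Longrightarrow> 0 < j \<Longrightarrow> f i j = 0"
  shows "leib n f = f 0 (Suc n)"
  using assms
proof (induction n arbitrary: f)
  case (Suc n)
  have "leib (Suc n) f = f (Suc 0) (Suc n) + f 0 (Suc (Suc n))"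
    unfolding leib.simps by (rule Suc.IH) (simp add: Suc.prems)
  then show ?case by (simp add: Suc.prems)
qed simp

lemma leib_zero: "leib n (\<lambda>i j. 0) = 0"
  by (induction n) simp_all

lemma diff_diff_diff: "(a - b) - (c - d) = (a - c) - (b - d)" for a b c d :: "'x::ab_group_add"
  by simp

section \<open>Linearity of the product and the span of all products\<close>

context bilinear_algebra
begin

lemmas linear_right_simps =
  module_hom.add[OF linear_right[unfolded linear_iff_module_hom]]
  module_hom.diff[OF linear_right[unfolded linear_iff_module_hom]]
  module_hom.zero[OF linear_right[unfolded linear_iff_module_hom]]
  module_hom.scale[OF linear_right[unfolded linear_iff_module_hom]]

lemmas linear_left_simps =
  module_hom.add[OF linear_left[unfolded linear_iff_module_hom]]
  module_hom.diff[OF linear_left[unfolded linear_iff_module_hom]]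
  module_hom.zero[OF linear_left[unfolded linear_iff_module_hom]]
  module_hom.scale[OF linear_left[unfolded linear_iff_module_hom]]

lemma product_in_space: "a \<odot> b \<in> product_space"
  unfolding product_space_def by (rule span_base) blast

lemma subspace_product_space: "subspace product_space"
  by (simp add: product_space_def)

lemmas product_space_simps =
  subspace_product_space[THEN subspace_0] subspace_product_space[THEN subspace_add]
  subspace_product_space[THEN subspace_scale]

lemma product_space_induct [consumes 1, case_names zero add scale product]:
  assumes "u \<in> product_space"
    and "P 0"
    and "\<And>u v. u \<in> product_space \<Longrightarrow> v \<in> product_space \<Longrightarrow> P u \<Longrightarrow> P v \<Longrightarrow> P (u + v)"
    and "\<And>c u. u \<in> product_space \<Longrightarrow> P u \<Longrightarrow> P (scale c u)"
    and "\<And>a b. P (a \<odot> b)"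
  shows "P u"
proof -
  have "subspace {u \<in> product_space. P u}"
    using assms(2-4) by (auto simp: subspace_def product_space_simps)
  then have "span {a \<odot> b |a b. True} \<subseteq> {u \<in> product_space. P u}"
    using assms(5) product_in_space by (intro span_minimal) auto
  then show ?thesis
    using assms(1) by (auto simp: product_space_def)
qed

end

section \<open>Symmetric functions representing elements of nonnegative weight\<close>

text \<open>Think of \<open>rho x v\<close> as d(x) v. Then \<open>mult_rho\<close> is the expansion
  of x d(d(y) v), with x d(d(y)) replaced by d(x d(y)) - d(x) d(y). Each \<open>rho x\<close> is
  total, so that linearity needs no domain conditions; among the laws of \<open>rho\<close> only
  \<open>mult_rho\<close> is restricted to \<open>V\<close>.\<close>

locale right_action = left_symmetric_algebra scale mult
  for scale :: "'k::field \<Rightarrow> 'a::ab_group_add \<Rightarrow> 'a" and mult (infixl "\<odot>" 70) +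
  fixes V :: "'a set" and rho :: "'a \<Rightarrow> 'a \<Rightarrow> 'a" and proj :: "'a \<Rightarrow> 'a"
  assumes subspace_V: "subspace V"
    and mult_in_V: "\<And>a b. a \<odot> b \<in> V"
    and rho_linear: "\<And>x. Vector_Spaces.linear scale scale (rho x)"
    and rho_add_left: "\<And>x y v. rho (x + y) v = rho x v + rho y v"
    and rho_scale_left: "\<And>c x v. rho (scale c x) v = scale c (rho x v)"
    and rho_in_V: "\<And>x v. rho x v \<in> V"
    and rho_commute: "\<And>x y v. rho x (rho y v) = rho y (rho x v)"
    and rho_mult: "\<And>x y v. rho y (x \<odot> v) = (x \<odot> y) \<odot> v"
    and mult_rho: "\<And>x y v. v \<in> V \<Longrightarrow>
      x \<odot> rho y v = rho y (x \<odot> v) + rho (x \<odot> y) v - rho y (rho x v)"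
    and proj_linear: "Vector_Spaces.linear scale scale proj"
    and proj_in_V: "\<And>v. proj v \<in> V"
    and proj_id: "\<And>v. v \<in> V \<Longrightarrow> proj v = v"
begin

lemmas rho_simps =
  module_hom.add[OF rho_linear[unfolded linear_iff_module_hom]]
  module_hom.diff[OF rho_linear[unfolded linear_iff_module_hom]]
  module_hom.zero[OF rho_linear[unfolded linear_iff_module_hom]]
  module_hom.scale[OF rho_linear[unfolded linear_iff_module_hom]]
  module_hom.sum[OF rho_linear[unfolded linear_iff_module_hom]]

lemmas mult_simps = linear_right_simps linear_left_simps

lemma rho_sum_mset: "rho x (\<Sum>y\<in>#M. f y) = (\<Sum>y\<in>#M. rho x (f y))"
  by (induction M) (simp_all add: rho_simps)

lemma mult_sum_mset: "x \<odot> (\<Sum>y\<in>#M. f y) = (\<Sum>y\<in>#M. x \<odot> f y)"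
  by (induction M) (simp_all add: mult_simps)

lemma scale_sum_mset: "scale c (\<Sum>y\<in>#M. f y) = (\<Sum>y\<in>#M. scale c (f y))"
  by (induction M) (simp_all add: scale_right_distrib)

lemma sum_mset_in_V: "(\<And>y. f y \<in> V) \<Longrightarrow> (\<Sum>y\<in>#M. f y) \<in> V"
  by (induction M) (simp_all add: subspace_V subspace_0 subspace_add)

lemma mult_left_symmetric:
  "a \<odot> (b \<odot> c) + (b \<odot> a) \<odot> c = b \<odot> (a \<odot> c) + (a \<odot> b) \<odot> c"
  using left_symmetric[of a b c] by (simp add: associator_def algebra_simps)

lemma mult_right_commute: "((x \<odot> y) \<odot> z) \<odot> u = ((x \<odot> z) \<odot> y) \<odot> u"
  by (metis rho_mult rho_commute)

text \<open>
  The last two conditions say that \<open>d(b a M g)\<close>, expanded as \<open>b d(v) + d(b) v\<close> with \<open>v = a M g\<close>,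
  and \<open>b d(d(c)) a M g\<close> are symmetric in \<open>a\<close> and \<open>b\<close>; the first of them makes \<open>der\<close> well
  defined, and the second one makes the first stable under \<open>rho\<close>.
\<close>
definition good :: "('a multiset \<Rightarrow> 'a) \<Rightarrow> bool" where
  "good g \<longleftrightarrow>
    (\<forall>N. g N \<in> V) \<and>
    (\<forall>a b N. g (add_mset (a + b) N) = g (add_mset a N) + g (add_mset b N)) \<and>
    (\<forall>c a N. g (add_mset (scale c a) N) = scale c (g (add_mset a N))) \<and>
    (\<forall>a c N. g (add_mset (a \<odot> c) N) = rho c (g (add_mset a N))) \<and>
    (\<forall>a b N. b \<odot> g (add_mset a N) + rho b (g (add_mset a N)) =
      a \<odot> g (add_mset b N) + rho a (g (add_mset b N))) \<and>
    (\<forall>a b c N. rho (b \<odot> c) (g (add_mset a N)) - rho b (rho c (g (add_mset a N))) =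
      rho (a \<odot> c) (g (add_mset b N)) - rho a (rho c (g (add_mset b N))))"

lemma goodD:
  assumes "good g"
  shows good_in_V: "g N \<in> V"
    and good_add: "g (add_mset (a + b) N) = g (add_mset a N) + g (add_mset b N)"
    and good_scale: "g (add_mset (scale k a) N) = scale k (g (add_mset a N))"
    and good_mult: "g (add_mset (a \<odot> c) N) = rho c (g (add_mset a N))"
    and good_sym: "b \<odot> g (add_mset a N) + rho b (g (add_mset a N)) =
      a \<odot> g (add_mset b N) + rho a (g (add_mset b N))"
    and good_sym2: "rho (b \<odot> c) (g (add_mset a N)) - rho b (rho c (g (add_mset a N))) =
      rho (a \<odot> c) (g (add_mset b N)) - rho a (rho c (g (add_mset b N)))"
  using assms unfolding good_def by blast+

text \<open>
  The Leibniz rule \<open>M d(g) = d(M g) - (\<Sum>x\<in>M. d(x) (M - x) g)\<close>. Since \<open>M g\<close> has weight \<open>-2\<close>,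
  its derivative is read off as \<open>a d(v) + d(a) v\<close> with \<open>v = (M - a) g\<close>; for functions that are
  \<open>good\<close>, the choice of \<open>a\<close> does not matter. At \<open>{#}\<close> the value is set to 0.
\<close>
definition der :: "('a multiset \<Rightarrow> 'a) \<Rightarrow> 'a multiset \<Rightarrow> 'a" where
  "der g M = (if M = {#} then 0 else
    (let a = (SOME a. a \<in># M) in a \<odot> g (M - {#a#}) + rho a (g (M - {#a#})))
      - (\<Sum>x\<in>#M. rho x (g (M - {#x#}))))"

lemma der_empty [simp]: "der g {#} = 0"
  by (simp add: der_def)

lemma der_add: "der (g + h) = der g + der h"
  by (auto simp: fun_eq_iff der_def Let_def rho_simps mult_simps sum_mset.distrib)

lemma der_scale: "der (\<lambda>N. scale c (g N)) = (\<lambda>N. scale c (der g N))"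
  by (auto simp: fun_eq_iff der_def Let_def rho_simps mult_simps scale_sum_mset
      scale_right_distrib scale_right_diff_distrib)

lemma der_add_mset:
  assumes "good g"
  shows "der g (add_mset a N) =
    a \<odot> g N - (\<Sum>x\<in>#N. rho x (g (add_mset a (N - {#x#}))))"
proof -
  define b where "b = (SOME b. b \<in># add_mset a N)"
  have b: "b \<in># add_mset a N"
    unfolding b_def by (rule someI[of _ a]) simp
  have tau: "b \<odot> g (add_mset a N - {#b#}) + rho b (g (add_mset a N - {#b#})) =
      a \<odot> g N + rho a (g N)"
  proof (cases "b = a")
    case False
    then obtain N' where "N = add_mset b N'"
      using b by (metis insert_DiffM insert_noteq_member)
    then show ?thesis
      using good_sym[OF assms, of b a N'] False by (simp add: add_mset_commute)
  qed simp
  have "(\<Sum>x\<in>#N. rho x (g (add_mset a N - {#x#}))) =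
      (\<Sum>x\<in>#N. rho x (g (add_mset a (N - {#x#}))))"
    by (rule arg_cong[where f = sum_mset], rule image_mset_cong) simp
  then show ?thesis
    unfolding der_def b_def[symmetric] Let_def using tau by simp
qed

lemma good_shift: "good g \<Longrightarrow> good (\<lambda>N. g (add_mset a N))"
  unfolding good_def by (metis add_mset_commute)

text \<open>This is a d(g) = d(a g) - d(a) g, obtained by expanding both derivatives at the same
  letter of M. At \<open>{#}\<close> it need not hold, because \<open>der\<close> is set to 0
  there.\<close>

lemma der_commute_add_mset:
  assumes "good g" and "M \<noteq> {#}"
  shows "der g (add_mset a M) = der (\<lambda>N. g (add_mset a N)) M - rho a (g M)"
proof -
  obtain b N where M: "M = add_mset b N"
    using assms(2) by (metis multiset_cases)
  have "(\<Sum>x\<in>#N. rho x (g (add_mset b (add_mset a N - {#x#})))) =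
      (\<Sum>x\<in>#N. rho x (g (add_mset b (add_mset a (N - {#x#})))))"
    by (rule arg_cong[where f = sum_mset], rule image_mset_cong) simp
  then show ?thesis
    using der_add_mset[OF assms(1), of b "add_mset a N"] der_add_mset[OF good_shift[OF assms(1)], of a b N]
    by (simp add: M add_mset_commute)
qed

lemma good_rho:
  assumes g: "good g"
  shows "good (\<lambda>N. rho x (g N))"
proof -
  note gD = goodD[OF g]
  have sym: "b \<odot> rho x (g (add_mset a K)) + rho b (rho x (g (add_mset a K))) =
      a \<odot> rho x (g (add_mset b K)) + rho a (rho x (g (add_mset b K)))" for a b K
  proof -
    have *: "b \<odot> rho x v + rho b (rho x v) = rho x (b \<odot> v + rho b v) +
        (rho (b \<odot> x) v - rho b (rho x v))" if "v \<in> V" for b v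
      using mult_rho[OF that, of b x] rho_commute[of x b v] by (simp add: rho_simps)
    show ?thesis
      by (simp only: *[OF gD(1)] gD(5)[of b a K] gD(6)[of b x a K])
  qed
  have sym2: "rho (b \<odot> c) (rho x (g (add_mset a K))) - rho b (rho c (rho x (g (add_mset a K)))) =
      rho (a \<odot> c) (rho x (g (add_mset b K))) - rho a (rho c (rho x (g (add_mset b K))))" for a b c K
  proof -
    have *: "rho (b \<odot> c) (rho x v) - rho b (rho c (rho x v)) =
        rho x (rho (b \<odot> c) v - rho b (rho c v))" for b v
      by (simp add: rho_simps) (metis rho_commute)
    show ?thesis
      by (simp only: * gD(6)[of b c a K])
  qed
  show ?thesis
    unfolding good_def using sym sym2
    by (simp add: gD rho_in_V rho_simps rho_commute[of _ x])
qed

text \<open>In both symmetry conditions the sums over N are handled by \<open>good_rho\<close>. What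
  remains is the leading term \<open>a \<odot> g N\<close>: there the first condition is
  left-symmetry, and the second one reduces to the symmetry of \<open>associator a b c\<close> in a
  and b.\<close>

lemma good_der:
  assumes g: "good g"
  shows "good (der g)"
proof -
  note gD = goodD[OF g] and der = der_add_mset[OF g]
  have inV: "der g N \<in> V" for N
  proof (cases N)
    case (add a N')
    then show ?thesis
      by (simp add: der mult_in_V rho_in_V sum_mset_in_V subspace_V subspace_diff)
  qed (simp add: subspace_V subspace_0)
  have sym: "b \<odot> der g (add_mset a N) + rho b (der g (add_mset a N)) =
      a \<odot> der g (add_mset b N) + rho a (der g (add_mset b N))" for a b N
  proof -
    have head: "b \<odot> (a \<odot> g N) + rho b (a \<odot> g N) = a \<odot> (b \<odot> g N) + rho a (b \<odot> g N)"
      using mult_left_symmetric[of a b "g N"] by (simp add: rho_mult)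
    have "(\<Sum>x\<in>#N. b \<odot> rho x (g (add_mset a (N - {#x#})))) +
        (\<Sum>x\<in>#N. rho b (rho x (g (add_mset a (N - {#x#}))))) =
        (\<Sum>x\<in>#N. a \<odot> rho x (g (add_mset b (N - {#x#})))) +
        (\<Sum>x\<in>#N. rho a (rho x (g (add_mset b (N - {#x#})))))"
      by (simp only: sum_mset.distrib[symmetric] goodD(5)[OF good_rho[OF g], of b _ a])
    with head show ?thesis
      by (simp add: der mult_simps rho_simps mult_sum_mset rho_sum_mset) (simp add: algebra_simps)
  qed
  have sym2: "rho (b \<odot> c) (der g (add_mset a N)) - rho b (rho c (der g (add_mset a N))) =
      rho (a \<odot> c) (der g (add_mset b N)) - rho a (rho c (der g (add_mset b N)))" for a b c N
  proof -
    have head: "rho (b \<odot> c) (a \<odot> g N) - rho b (rho c (a \<odot> g N)) =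
        rho (a \<odot> c) (b \<odot> g N) - rho a (rho c (b \<odot> g N))"
    proof -
      have *: "rho (b \<odot> c) (a \<odot> v) - rho b (rho c (a \<odot> v)) = - (associator a b c \<odot> v)" for a b v
        using mult_right_commute[of a b c v]
        by (simp add: rho_mult associator_def mult_simps)
      show ?thesis
        by (simp only: * left_symmetric[of a b c])
    qed
    have sd: "(\<Sum>x\<in>#N. f x) - (\<Sum>x\<in>#N. h x) = (\<Sum>x\<in>#N. f x - h x)" for f h :: "'a \<Rightarrow> 'a"
      by (induction N) simp_all
    have "(\<Sum>x\<in>#N. rho (b \<odot> c) (rho x (g (add_mset a (N - {#x#}))))) -
        (\<Sum>x\<in>#N. rho b (rho c (rho x (g (add_mset a (N - {#x#})))))) =
        (\<Sum>x\<in>#N. rho (a \<odot> c) (rho x (g (add_mset b (N - {#x#}))))) -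
        (\<Sum>x\<in>#N. rho a (rho c (rho x (g (add_mset b (N - {#x#}))))))"
      by (simp only: sd goodD(6)[OF good_rho[OF g], of b c _ a])
    with head show ?thesis
      by (simp add: der rho_simps rho_sum_mset) (simp add: algebra_simps)
  qed
  have prod: "der g (add_mset (a \<odot> c) N) = rho c (der g (add_mset a N))" for a c N
    by (simp add: der rho_simps rho_sum_mset gD(4) rho_mult rho_commute[of c])
  show ?thesis
    unfolding good_def using inV sym sym2 prod
    by (simp add: der gD(2,3) mult_simps rho_simps sum_mset.distrib scale_sum_mset
        scale_right_diff_distrib)
qed

section \<open>Operators of multiplication by derivatives of a letter\<close>

fun act :: "nat \<Rightarrow> 'a \<Rightarrow> ('a multiset \<Rightarrow> 'a) \<Rightarrow> 'a multiset \<Rightarrow> 'a" where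
  "act 0 a g = (\<lambda>N. g (add_mset a N))"
| "act (Suc 0) a g = (\<lambda>N. rho a (g N))"
| "act (Suc (Suc n)) a g = der (act (Suc n) a g) - act (Suc n) a (der g)"

lemma act_der:
  assumes "0 < n"
  shows "der (act n a g) = act (Suc n) a g + act n a (der g)"
  using assms by (cases n) simp_all

text \<open>Order 1 is the commutator of \<open>der\<close> with order 0 only away from
  \<open>{#}\<close>; at \<open>{#}\<close> that commutator gives \<open>- (a \<odot> g {#})\<close>
  instead of \<open>rho a (g {#})\<close>. Hence \<open>act 1\<close> is defined by
  \<open>rho\<close>, and commutators start at order 2.\<close>

lemma act_zero_der:
  assumes "good g" and "M \<noteq> {#}"
  shows "der (act 0 a g) M = act 1 a g M + act 0 a (der g) M"
  using der_commute_add_mset[OF assms] by simp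

lemma good_diff:
  assumes g: "good g" and h: "good h"
  shows "good (g - h)"
proof -
  have sym: "b \<odot> u + rho b u = a \<odot> v + rho a v \<Longrightarrow> b \<odot> u' + rho b u' = a \<odot> v' + rho a v' \<Longrightarrow>
      b \<odot> (u - u') + rho b (u - u') = a \<odot> (v - v') + rho a (v - v')" for a b u v u' v'
    by (simp add: mult_simps rho_simps flip: add_diff_add)
  have sym2: "x - rho b (rho c u) = y - rho a (rho c v) \<Longrightarrow>
      x' - rho b (rho c u') = y' - rho a (rho c v') \<Longrightarrow>
      (x - x') - rho b (rho c (u - u')) = (y - y') - rho a (rho c (v - v'))"
    for a b c u v u' v' x y x' y'
    by (simp only: rho_simps diff_diff_diff[of x x'] diff_diff_diff[of y y'])
  show ?thesis
    unfolding good_def using sym[OF good_sym[OF g] good_sym[OF h]]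
      sym2[OF good_sym2[OF g] good_sym2[OF h]]
    by (simp add: goodD[OF g] goodD[OF h] subspace_V subspace_diff rho_simps scale_right_diff_distrib)
qed

lemma good_act: "good g \<Longrightarrow> good (act n a g)"
proof (induction n a g rule: act.induct)
  case (3 n a g)
  show ?case
    unfolding act.simps by (intro good_diff good_der 3)
qed (simp_all add: good_shift good_rho)

lemma act_add: "act n a (g + h) = act n a g + act n a h"
proof (induction n a g arbitrary: h rule: act.induct)
  case (3 n a g)
  show ?case
    by (simp only: act.simps 3 der_add add_diff_add)
qed (simp_all add: fun_eq_iff rho_simps)

lemma act_scale: "act n a (\<lambda>N. scale c (g N)) = (\<lambda>N. scale c (act n a g N))"
proof (induction n a g rule: act.induct)
  case (3 n a g)
  then show ?case
    by (simp only: act.simps der_scale) (simp add: fun_eq_iff scale_right_diff_distrib)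
qed (simp_all add: fun_eq_iff rho_simps)

lemma act_diff: "act n a (g - h) = act n a g - act n a h"
  using act_add[of n a "g - h" h] by (simp add: algebra_simps)

lemma act_add_left: "good g \<Longrightarrow> act n (a + b) g = act n a g + act n b g"
proof (induction n a g rule: act.induct)
  case (3 n a g)
  then show ?case
    by (simp only: act.simps good_der der_add add_diff_add)
qed (simp_all add: fun_eq_iff good_add rho_add_left)

lemma act_scale_left: "good g \<Longrightarrow> act n (scale c a) g = (\<lambda>N. scale c (act n a g N))"
proof (induction n a g rule: act.induct)
  case (3 n a g)
  then show ?case
    by (simp only: act.simps good_der der_scale) (simp add: fun_eq_iff scale_right_diff_distrib)
qed (simp_all add: fun_eq_iff good_scale rho_scale_left)

section \<open>Vanishing on small multisets\<close>

definition vanishes_below :: "nat \<Rightarrow> ('a multiset \<Rightarrow> 'a) \<Rightarrow> bool" where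
  "vanishes_below k g \<longleftrightarrow> (\<forall>N. size N < k \<longrightarrow> g N = 0)"

lemma vanishes_below_der:
  assumes "good g" and "vanishes_below k g"
  shows "vanishes_below (Suc k) (der g)"
  unfolding vanishes_below_def
proof (intro allI impI)
  fix N :: "'a multiset"
  assume N: "size N < Suc k"
  show "der g N = 0"
  proof (cases N)
    case (add a M)
    have "g (add_mset a (M - {#x#})) = 0" if "x \<in># M" for x
      using assms(2) N add that unfolding vanishes_below_def
      by (metis add_mset_remove_trivial insert_DiffM less_Suc_eq not_less_eq size_add_mset)
    then have "(\<Sum>x\<in>#M. rho x (g (add_mset a (M - {#x#})))) = (\<Sum>x\<in>#M. 0)"
      by (intro arg_cong[where f = sum_mset] image_mset_cong) (simp add: rho_simps)
    then show ?thesis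
      using assms(2) N unfolding vanishes_below_def
      by (simp add: add der_add_mset[OF assms(1)] mult_simps)
  qed simp
qed

text \<open>Order 1 keeps the bound, and each further commutator with \<open>der\<close> raises it
  by one. The bound settles evaluation at \<open>{#}\<close>, where the Leibniz rule for order 0 is
  missing.\<close>

lemma vanishes_below_act:
  "good g \<Longrightarrow> vanishes_below k g \<Longrightarrow> vanishes_below (k + n) (act (Suc n) a g)"
proof (induction n arbitrary: g k)
  case 0
  then show ?case by (simp add: vanishes_below_def rho_simps)
next
  case (Suc n)
  have "vanishes_below (Suc (k + n)) (der (act (Suc n) a g))"
    using Suc by (intro vanishes_below_der good_act)
  moreover have "vanishes_below (Suc k + n) (act (Suc n) a (der g))"
    using Suc by (intro Suc.IH vanishes_below_der good_der)
  ultimately show ?case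
    by (simp add: vanishes_below_def)
qed

lemma vanishes_below_0 [simp]: "vanishes_below 0 g"
  by (simp add: vanishes_below_def)

lemma act_eq_0:
  assumes "good g" and "size N < n"
  shows "act (Suc n) a g N = 0"
  using vanishes_below_act[OF assms(1) vanishes_below_0, of n a] assms(2)
  by (simp add: vanishes_below_def)

lemma act_act_eq_0:
  assumes "good g" and "size N < m + n"
  shows "act (Suc m) a (act (Suc n) c g) N = 0"
  using vanishes_below_act[OF good_act[OF assms(1)]
      vanishes_below_act[OF assms(1) vanishes_below_0], of n m a c] assms(2)
  by (simp add: vanishes_below_def add.commute)

text \<open>Order n + 1 comes from order n by applying \<open>der\<close> to the identity for g and
  subtracting the identity for \<open>der g\<close>. The passage from 0 to 1 cannot go this way,
  since at \<open>{#}\<close> the operator \<open>act 1\<close> is not the commutator of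
  \<open>der\<close> with \<open>act 0\<close>; it rests on \<open>mult_rho\<close> instead.\<close>

lemma act_mult:
  assumes "good g"
  shows "leib n (\<lambda>i j. act i a (act j c g)) = act n (a \<odot> c) g"
  using assms
proof (induction n arbitrary: g)
  case 0
  then show ?case by (simp add: fun_eq_iff good_mult)
next
  case (Suc n)
  note g = Suc.prems
  show ?case
  proof (cases n)
    case 0
    have "rho a (rho c (g N)) + (der (\<lambda>N. rho c (g N)) (add_mset a N) - rho c (der g (add_mset a N)))
        = rho (a \<odot> c) (g N)" for N
      using mult_rho[OF good_in_V[OF g], of a c N]
      by (simp add: der_add_mset[OF g] der_add_mset[OF good_rho[OF g]] rho_simps rho_sum_mset
          rho_commute[of c])
    then show ?thesis
      by (simp add: 0 fun_eq_iff)
  next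
    case (Suc m)
    show ?thesis
    proof
      fix N
      let ?f = "\<lambda>i j. act i a (act j c g)"
      show "leib (Suc n) ?f N = act (Suc n) (a \<odot> c) g N"
      proof (cases "N = {#}")
        case True
        have "leib (Suc n) ?f N = leib (Suc n) (\<lambda>i j. ?f i j N)"
          by (rule leib_additive[of "\<lambda>h. h N"]) simp
        also have "\<dots> = leib (Suc n) (\<lambda>i j. 0)"
        proof (rule leib_cong)
          fix i j
          assume ij: "i + j = Suc (Suc n)" "0 < j"
          then obtain j' where j': "j = Suc j'" by (cases j) auto
          show "?f i j N = 0"
          proof (cases i)
            case 0
            then show ?thesis using ij j' Suc True
              by (auto simp: act.simps(1) simp del: act.simps(3) intro!: act_eq_0[OF g])
          next
            case (Suc i')
            then show ?thesis using ij j' \<open>n = Suc m\<close> True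
              by (auto simp del: act.simps intro!: act_act_eq_0[OF g])
          qed
        qed
        also have "\<dots> = act (Suc n) (a \<odot> c) g N"
          using act_eq_0[OF g, of N n] True Suc by (simp add: leib_zero del: act.simps)
        finally show ?thesis .
      next
        case False
        have step: "?f (Suc i) j N + ?f i (Suc j) N = der (?f i j) N - act i a (act j c (der g)) N"
          if "0 < j" for i j
        proof (cases i)
          case 0
          then show ?thesis
            using act_zero_der[OF good_act[OF g] False, of a j c] act_der[OF that, of c g]
            by simp
        next
          case (Suc i')
          then have "der (?f i j) = ?f (Suc i) j + act i a (der (act j c g))"
            by (intro act_der) simp
          then show ?thesis
            using act_der[OF that, of c g] by (simp add: act_add del: act.simps)
        qed
        have "leib (Suc n) ?f N = leib n (\<lambda>i j. (?f (Suc i) j + ?f i (Suc j)) N)"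
          unfolding leib.simps by (rule leib_additive[of "\<lambda>h. h N"]) simp
        also have "\<dots> = leib n (\<lambda>i j. der (?f i j) N - act i a (act j c (der g)) N)"
          by (rule leib_cong) (simp add: step del: act.simps)
        also have "\<dots> = leib n (\<lambda>i j. der (?f i j) N) - leib n (\<lambda>i j. act i a (act j c (der g)) N)"
          by (simp add: leib_diff)
        also have "leib n (\<lambda>i j. der (?f i j) N) = der (leib n ?f) N"
          by (rule leib_additive[of "\<lambda>h. der h N", symmetric]) (simp add: der_add)
        also have "leib n (\<lambda>i j. act i a (act j c (der g)) N) =
            leib n (\<lambda>i j. act i a (act j c (der g))) N"
          by (rule leib_additive[of "\<lambda>h. h N", symmetric]) simp
        finally show ?thesis
          using Suc.IH[OF g] Suc.IH[OF good_der[OF g]] Suc by simp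
      qed
    qed
  qed
qed

text \<open>
  Lowering by \<open>b\<close> turns \<open>c\<^sup>(\<^sup>n\<^sup>+\<^sup>1\<^sup>)\<close> into the boundary term of \<open>act_mult\<close> for \<open>b \<odot> c\<close>, all of whose
  other terms have lower order.
\<close>
lemma act_rho_commute:
  "good g \<Longrightarrow> act (Suc n) c (\<lambda>N. rho a (g N)) = (\<lambda>N. rho a (act (Suc n) c g N))"
proof (induction n arbitrary: a c g rule: less_induct)
  case (less n)
  note g = less.prems
  show ?case
  proof (cases n)
    case 0
    then show ?thesis by (simp add: rho_commute[of c])
  next
    case (Suc m)
    have IH: "rho a (act j c g N) = act j c (\<lambda>N. rho a (g N)) N"
      if "0 < j" "j \<le> n" "good g" for j c g N
      using less.IH[of "j - 1" g c a] that by simp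
    show ?thesis
    proof
      fix N
      show "act (Suc n) c (\<lambda>N. rho a (g N)) N = rho a (act (Suc n) c g N)"
      proof (cases N)
        case empty
        then show ?thesis
          using act_eq_0[OF g, of N n] act_eq_0[OF good_rho[OF g], of N n] Suc
          by (simp add: rho_simps del: act.simps)
      next
        case (add b M)
        let ?f = "\<lambda>i j. rho a (act i b (act j c g) M) - act i b (act j c (\<lambda>N. rho a (g N))) M"
        have "leib n ?f = leib n (\<lambda>i j. rho a (act i b (act j c g) M)) -
            leib n (\<lambda>i j. act i b (act j c (\<lambda>N. rho a (g N))) M)"
          by (simp only: leib_diff)
        also have "leib n (\<lambda>i j. rho a (act i b (act j c g) M)) =
            rho a (leib n (\<lambda>i j. act i b (act j c g)) M)"
          by (rule leib_additive[of "\<lambda>h. rho a (h M)", symmetric]) (simp add: rho_simps)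
        also have "leib n (\<lambda>i j. act i b (act j c (\<lambda>N. rho a (g N))) M) =
            leib n (\<lambda>i j. act i b (act j c (\<lambda>N. rho a (g N)))) M"
          by (rule leib_additive[of "\<lambda>h. h M", symmetric]) simp
        also have "rho a (leib n (\<lambda>i j. act i b (act j c g)) M) -
            leib n (\<lambda>i j. act i b (act j c (\<lambda>N. rho a (g N)))) M = 0"
          using Suc by (simp only: act_mult[OF g] act_mult[OF good_rho[OF g]]) (simp add: IH g)
        finally have "leib n ?f = 0" .
        moreover have "leib n ?f = ?f 0 (Suc n)"
        proof (rule leib_boundary)
          fix i j
          assume "i + j = Suc n" "0 < i" "0 < j"
          then have "i \<le> n" "j \<le> n" by simp_all
          have "act j c (\<lambda>N. rho a (g N)) = (\<lambda>N. rho a (act j c g N))"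
            using IH[OF \<open>0 < j\<close> \<open>j \<le> n\<close> g] by (simp add: fun_eq_iff)
          then show "?f i j = 0"
            using IH[OF \<open>0 < i\<close> \<open>i \<le> n\<close> good_act[OF g]] by simp
        qed
        ultimately show ?thesis
          by (simp add: add)
      qed
    qed
  qed
qed

text \<open>Order m + 2 is the commutator of \<open>der\<close> with order m + 1, so the induction
  on m is the Jacobi identity; n stays arbitrary because differentiating
  \<open>act (Suc n) c\<close> raises its order.\<close>

lemma act_commute:
  "good g \<Longrightarrow> act (Suc m) a (act (Suc n) c g) = act (Suc n) c (act (Suc m) a g)"
proof (induction m arbitrary: n g)
  case 0
  then show ?case by (simp add: act_rho_commute del: act.simps(3))
next
  case (Suc m)
  note g = Suc.prems
  have "act (Suc (Suc m)) a (act (Suc n) c g) =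
      der (act (Suc m) a (act (Suc n) c g)) - act (Suc m) a (der (act (Suc n) c g))"
    by simp
  also have "\<dots> = der (act (Suc n) c (act (Suc m) a g)) -
      (act (Suc (Suc n)) c (act (Suc m) a g) + act (Suc n) c (act (Suc m) a (der g)))"
    by (simp only: act_der[of "Suc n"] zero_less_Suc act_add Suc.IH[OF g] Suc.IH[OF good_der[OF g]])
  also have "\<dots> = act (Suc n) c (der (act (Suc m) a g) - act (Suc m) a (der g))"
    by (simp only: act_der[of "Suc n"] zero_less_Suc act_diff) simp
  finally show ?case
    by (simp only: act.simps)
qed

lemma act_zero_der':
  assumes "good g" and "g {#} = 0"
  shows "der (act 0 a g) = act 1 a g + act 0 a (der g)"
proof
  fix M
  show "der (act 0 a g) M = (act 1 a g + act 0 a (der g)) M"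
  proof (cases "M = {#}")
    case True
    then show ?thesis
      using assms by (simp add: der_add_mset mult_simps rho_simps)
  next
    case False
    then show ?thesis
      using act_zero_der[OF assms(1)] by simp
  qed
qed

lemma act_empty:
  assumes "good g" and "g {#} = 0"
  shows "act (Suc n) a g {#} = 0"
  using vanishes_below_act[OF assms(1), of 1 n a] assms(2) by (simp add: vanishes_below_def)

lemma act_zero_commute:
  "good g \<Longrightarrow> g {#} = 0 \<Longrightarrow> act 0 a (act (Suc n) c g) = act (Suc n) c (act 0 a g)"
proof (induction n arbitrary: g)
  case (Suc n)
  note g = Suc.prems
  have "act 0 a (act (Suc (Suc n)) c g) =
      act 0 a (der (act (Suc n) c g)) - act 0 a (act (Suc n) c (der g))"
    by (simp only: act.simps(3) act_diff)
  also have "act 0 a (der (act (Suc n) c g)) =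
      der (act 0 a (act (Suc n) c g)) - act 1 a (act (Suc n) c g)"
    using act_zero_der'[OF good_act[OF g(1)] act_empty[OF g], of a] by simp
  also have "act 1 a (act (Suc n) c g) = act (Suc n) c (act 1 a g)"
    using act_commute[OF g(1), of 0] by simp
  also have "der (act 0 a (act (Suc n) c g)) = der (act (Suc n) c (act 0 a g))"
    by (simp only: Suc.IH[OF g])
  also have "act 0 a (act (Suc n) c (der g)) = act (Suc n) c (act 0 a (der g))"
    by (rule Suc.IH) (simp_all add: g good_der)
  also have "act 0 a (der g) = der (act 0 a g) - act 1 a g"
    using act_zero_der'[OF g, of a] by simp
  finally show ?case
    by (simp only: act_diff act.simps(3)) simp
qed simp

section \<open>Action of words on symmetric functions\<close>

fun acts :: "('a \<times> nat) list \<Rightarrow> ('a multiset \<Rightarrow> 'a) \<Rightarrow> 'a multiset \<Rightarrow> 'a" where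
  "acts [] g = g"
| "acts ((a, n) # u) g = (if n = 0 then acts u g else act n a (acts u g))"

text \<open>\<open>acts\<close> skips these letters; they form the multiset at which its result is
  evaluated. Feeding them in earlier need not commute with the operators of positive order unless
  the function vanishes at \<open>{#}\<close>.\<close>

definition order_zero :: "('a \<times> nat) list \<Rightarrow> 'a multiset" where
  "order_zero u = mset (map fst (filter (\<lambda>x. snd x = 0) u))"

lemma order_zero_simps [simp]:
  "order_zero [] = {#}"
  "order_zero ((a, 0) # u) = add_mset a (order_zero u)"
  "order_zero ((a, Suc n) # u) = order_zero u"
  "order_zero (u @ v) = order_zero u + order_zero v"
  by (simp_all add: order_zero_def)

lemma good_acts: "good g \<Longrightarrow> good (acts u g)"
  by (induction u g rule: acts.induct) (simp_all add: good_act)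

lemma acts_append: "acts (u @ v) g = acts u (acts v g)"
  by (induction u g rule: acts.induct) simp_all

lemma acts_add: "acts u (g + h) = acts u g + acts u h"
  by (induction u g arbitrary: h rule: acts.induct) (auto simp: act_add)

lemma acts_scale: "acts u (\<lambda>N. scale c (g N)) = (\<lambda>N. scale c (acts u g N))"
  by (induction u g rule: acts.induct) (simp_all add: act_scale)

lemma act_acts_commute: "good g \<Longrightarrow> act (Suc n) a (acts u g) = acts u (act (Suc n) a g)"
proof (induction u g rule: acts.induct)
  case (2 b m u g)
  then show ?case
    by (cases m) (simp_all add: act_commute[OF good_acts] del: act.simps)
qed simp

lemma act_zero_acts_commute:
  assumes "good g" and "g {#} = 0"
  shows "act 0 a (acts u g) = acts u (act 0 a g)"
proof -
  have "acts u g {#} = 0 \<and> act 0 a (acts u g) = acts u (act 0 a g)"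
    using assms
  proof (induction u g rule: acts.induct)
    case (2 b m u g)
    show ?case
    proof (cases m)
      case 0
      with 2 show ?thesis by simp
    next
      case (Suc k)
      with 2 show ?thesis
        using act_zero_commute[OF good_acts, of g u a k b] act_empty[OF good_acts, of g u k b]
        by (simp del: act.simps)
    qed
  qed simp
  then show ?thesis ..
qed

lemma acts_swap:
  assumes "good g"
  shows "acts (p @ x # y # q) g = acts (p @ y # x # q) g"
proof -
  obtain a m b n where "x = (a, m)" "y = (b, n)"
    by (cases x, cases y)
  then show ?thesis
    using act_commute[OF good_acts[OF assms], of "m - 1" a "n - 1" b q]
    by (cases m; cases n) (simp_all add: acts_append del: act.simps)
qed

section \<open>Derivatives of the last letter, and evaluation of words\<close>

definition point :: "'a \<Rightarrow> 'a multiset \<Rightarrow> 'a" where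
  "point v N = (if N = {#} then v else 0)"

text \<open>Represents d(b), whose product with a is \<open>a \<odot> b\<close>. The sum over a
  singleton multiset extracts its element, so no choice is involved.\<close>

definition germ :: "'a \<Rightarrow> 'a multiset \<Rightarrow> 'a" where
  "germ b N = (if size N = 1 then (\<Sum>\<^sub># N) \<odot> b else 0)"

fun jet :: "'a \<times> nat \<Rightarrow> 'a multiset \<Rightarrow> 'a" where
  "jet (b, 0) = point (proj b)"
| "jet (b, Suc k) = (der ^^ k) (germ b)"

lemma good_point: "v \<in> V \<Longrightarrow> good (point v)"
  by (simp add: good_def point_def subspace_V subspace_0 mult_simps rho_simps)

lemma good_germ: "good (germ b)"
proof -
  have "b' \<odot> (a \<odot> b) + (a \<odot> b') \<odot> b = a \<odot> (b' \<odot> b) + (b' \<odot> a) \<odot> b" for a b'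
    using mult_left_symmetric[of b' a b] by simp
  moreover have "(a \<odot> (b' \<odot> c)) \<odot> b - ((a \<odot> c) \<odot> b') \<odot> b = (b' \<odot> (a \<odot> c)) \<odot> b - ((b' \<odot> c) \<odot> a) \<odot> b"
    for a b' c
    using left_symmetric[of a b' c] mult_right_commute[of a c b' b] mult_right_commute[of b' c a b]
    by (simp add: associator_def mult_simps flip: mult_simps(6)) (metis diff_eq_eq mult_simps(6) minus_diff_eq)
  ultimately show ?thesis
    by (auto simp: good_def germ_def subspace_V subspace_0 mult_simps rho_simps mult_in_V rho_mult)
qed

lemma germ_empty [simp]: "germ b {#} = 0"
  by (simp add: germ_def)

lemma good_der_pow: "good g \<Longrightarrow> good ((der ^^ k) g)"
  by (induction k) (simp_all add: good_der)

lemma good_jet: "good (jet x)"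
proof (cases x)
  case (Pair b n)
  then show ?thesis
    by (cases n) (simp_all add: good_point proj_in_V good_germ good_der_pow)
qed

lemma der_pow_empty: "g {#} = 0 \<Longrightarrow> (der ^^ k) g {#} = 0"
  by (cases k) simp_all

lemma der_point: "v \<in> V \<Longrightarrow> der (point v) = germ v"
proof
  fix N
  assume "v \<in> V"
  then show "der (point v) N = germ v N"
    by (cases N) (auto simp: der_add_mset good_point point_def germ_def mult_simps rho_simps)
qed

lemma act_zero_germ: "act 0 a (germ b) = point (a \<odot> b)"
  by (auto simp: fun_eq_iff germ_def point_def)

lemma jet_in_V: "v \<in> V \<Longrightarrow> jet (v, n) = (der ^^ n) (point v)"
  by (cases n) (simp_all add: proj_id der_point funpow_Suc_right del: funpow.simps(2))

text \<open>The iterated Leibniz rule for the product a g. In the application g is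
  \<open>germ b\<close>, already of order 1, so order j means j - 1 applications of
  \<open>der\<close>.\<close>

lemma leib_der_pow:
  assumes "good g" and "g {#} = 0"
  shows "leib n (\<lambda>i j. act i a ((der ^^ (j - 1)) g)) = (der ^^ n) (act 0 a g)"
proof (induction n)
  case 0
  then show ?case by simp
next
  case (Suc n)
  have step: "act (Suc i) a ((der ^^ (j - 1)) g) + act i a ((der ^^ (Suc j - 1)) g) =
      der (act i a ((der ^^ (j - 1)) g))" if "0 < j" for i j
  proof -
    have "der (act i a h) = act (Suc i) a h + act i a (der h)" if "good h" "h {#} = 0" for h
      using act_zero_der'[OF that, of a] act_der[of i a h] by (cases i) simp_all
    moreover have "(der ^^ (j - 1)) g {#} = 0"
      using assms(2) by (rule der_pow_empty)
    ultimately have "der (act i a ((der ^^ (j - 1)) g)) =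
        act (Suc i) a ((der ^^ (j - 1)) g) + act i a (der ((der ^^ (j - 1)) g))"
      using good_der_pow[OF assms(1)] by blast
    then show ?thesis
      using that by (cases j) simp_all
  qed
  have "leib (Suc n) (\<lambda>i j. act i a ((der ^^ (j - 1)) g)) =
      leib n (\<lambda>i j. der (act i a ((der ^^ (j - 1)) g)))"
    unfolding leib.simps by (rule leib_cong) (rule step)
  also have "\<dots> = der (leib n (\<lambda>i j. act i a ((der ^^ (j - 1)) g)))"
    by (rule leib_additive[of der, OF der_add, symmetric])
  finally show ?case
    by (simp only: Suc funpow.simps comp_apply)
qed

lemma leib_jet: "leib n (\<lambda>i j. act i a (jet (b, j))) = jet (a \<odot> b, n)"
proof -
  have "leib n (\<lambda>i j. act i a (jet (b, j))) = leib n (\<lambda>i j. act i a ((der ^^ (j - 1)) (germ b)))"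
  proof (rule leib_cong)
    fix i j :: nat
    assume "0 < j"
    then show "act i a (jet (b, j)) = act i a ((der ^^ (j - 1)) (germ b))"
      by (cases j) simp_all
  qed
  also have "\<dots> = jet (a \<odot> b, n)"
    by (simp only: leib_der_pow[OF good_germ germ_empty] act_zero_germ jet_in_V[OF mult_in_V])
  finally show ?thesis .
qed

lemmas proj_simps =
  module_hom.add[OF proj_linear[unfolded linear_iff_module_hom]]
  module_hom.scale[OF proj_linear[unfolded linear_iff_module_hom]]

lemma jet_add: "jet (b + b', n) = jet (b, n) + jet (b', n)"
proof (cases n)
  case 0
  then show ?thesis
    by (simp add: fun_eq_iff point_def proj_simps)
next
  case (Suc k)
  have "(der ^^ k) (germ (b + b')) = (der ^^ k) (germ b) + (der ^^ k) (germ b')"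
  proof (induction k)
    case (Suc k)
    then show ?case by (simp only: funpow.simps comp_apply der_add)
  qed (simp add: fun_eq_iff germ_def mult_simps)
  then show ?thesis by (simp add: Suc)
qed

lemma jet_scale: "jet (scale c b, n) = (\<lambda>N. scale c (jet (b, n) N))"
proof (cases n)
  case 0
  then show ?thesis
    by (simp add: fun_eq_iff point_def proj_simps)
next
  case (Suc k)
  have "(der ^^ k) (germ (scale c b)) = (\<lambda>N. scale c ((der ^^ k) (germ b) N))"
    by (induction k) (simp add: fun_eq_iff germ_def mult_simps, simp add: der_scale)
  then show ?thesis by (simp add: Suc)
qed

text \<open>
  Letters of positive order raise the weight and are applied before the letters of order 0 are
  fed in. In last position a letter of order 0 is projected to \<open>V\<close>, which is harmless because
  only the derivatives of the last letter occur in the relations; a single letter has to be kept.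
\<close>
definition word_value :: "('a \<times> nat) list \<Rightarrow> 'a" where
  "word_value w = (if w = [] then 0 else
    if butlast w = [] \<and> snd (last w) = 0 then fst (last w)
    else acts (butlast w) (jet (last w)) (order_zero (butlast w)))"

lemma word_value_snoc:
  "p \<noteq> [] \<or> snd x \<noteq> 0 \<Longrightarrow> word_value (p @ [x]) = acts p (jet x) (order_zero p)"
  by (auto simp: word_value_def)

lemma word_value_single: "word_value [(b, 0)] = b"
  by (simp add: word_value_def)

text \<open>The trailing z reflects that the Perm identity never moves the last letter. The other
  letters act by commuting operators or enter a multiset argument.\<close>

lemma word_value_swap: "word_value (p @ [x, y] @ q @ [z]) = word_value (p @ [y, x] @ q @ [z])"
proof -
  have "order_zero [x, y] = order_zero [y, x]"
    by (simp add: order_zero_def add_mset_commute)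
  then have "order_zero (p @ [x, y] @ q) = order_zero (p @ [y, x] @ q)"
    by (simp only: order_zero_simps)
  then show ?thesis
    using word_value_snoc[of "p @ [x, y] @ q" z] word_value_snoc[of "p @ [y, x] @ q" z]
      acts_swap[OF good_jet, of p x y q z]
    by simp
qed

lemma word_value_add:
  "word_value (p @ [(a + b, n)] @ q) = word_value (p @ [(a, n)] @ q) + word_value (p @ [(b, n)] @ q)"
proof (cases q rule: rev_cases)
  case Nil
  show ?thesis
  proof (cases "p = [] \<and> n = 0")
    case True
    then show ?thesis by (simp add: Nil word_value_single)
  next
    case False
    then show ?thesis
      by (simp add: Nil word_value_snoc jet_add acts_add)
  qed
next
  case (snoc q' z)
  have *: "word_value (p @ [x] @ q) = acts p (acts [x] (acts q' (jet z))) (order_zero (p @ [x] @ q'))" for x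
    using word_value_snoc[of "p @ [x] @ q'" z] by (cases x) (simp add: snoc acts_append)
  let ?h = "acts q' (jet z)"
  have h: "good ?h"
    by (simp add: good_acts good_jet)
  show ?thesis
  proof (cases n)
    case 0
    then show ?thesis
      unfolding * by (simp add: good_add[OF good_acts[OF h]])
  next
    case (Suc k)
    have "acts p (act n (a + b) ?h) = acts p (act n a ?h) + acts p (act n b ?h)"
      by (simp only: act_add_left[OF h] acts_add)
    then show ?thesis
      unfolding * by (simp add: Suc del: act.simps)
  qed
qed

lemma word_value_scale:
  "word_value (p @ [(scale c a, n)] @ q) = scale c (word_value (p @ [(a, n)] @ q))"
proof (cases q rule: rev_cases)
  case Nil
  show ?thesis
  proof (cases "p = [] \<and> n = 0")
    case True
    then show ?thesis by (simp add: Nil word_value_single)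
  next
    case False
    then show ?thesis
      by (simp add: Nil word_value_snoc jet_scale acts_scale)
  qed
next
  case (snoc q' z)
  have *: "word_value (p @ [x] @ q) = acts p (acts [x] (acts q' (jet z))) (order_zero (p @ [x] @ q'))" for x
    using word_value_snoc[of "p @ [x] @ q'" z] by (cases x) (simp add: snoc acts_append)
  let ?h = "acts q' (jet z)"
  have h: "good ?h"
    by (simp add: good_acts good_jet)
  show ?thesis
  proof (cases n)
    case 0
    then show ?thesis
      unfolding * by (simp add: good_scale[OF good_acts[OF h]])
  next
    case (Suc k)
    have "acts p (act n (scale c a) ?h) = (\<lambda>N. scale c (acts p (act n a ?h) N))"
      by (simp only: act_scale_left[OF h] acts_scale)
    then show ?thesis
      unfolding * by (simp add: Suc del: act.simps)
  qed
qed

lemma word_value_mult: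
  "leib n (\<lambda>i j. word_value (p @ [(a, i), (b, j)] @ q)) = word_value (p @ [(a \<odot> b, n)] @ q)"
proof (cases q rule: rev_cases)
  case Nil
  have "leib n (\<lambda>i j. word_value (p @ [(a, i), (b, j)] @ q)) =
      leib n (\<lambda>i j. acts p (act i a (jet (b, j))) (order_zero p))"
  proof (rule leib_cong)
    fix i j :: nat
    assume "0 < j"
    then have empty: "jet (b, j) {#} = 0"
      by (cases j) (simp_all add: der_pow_empty)
    have "word_value (p @ [(a, i), (b, j)] @ q) =
        acts (p @ [(a, i)]) (jet (b, j)) (order_zero (p @ [(a, i)]))"
      using word_value_snoc[of "p @ [(a, i)]" "(b, j)"] by (simp add: Nil)
    \<comment> \<open>For i = 0 the letter a, fed in after the operators of p, is moved next to the
      last letter. This needs \<open>jet (b, j)\<close> to vanish at \<open>{#}\<close>, which holds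
      because j is positive.\<close>
    also have "\<dots> = acts p (act i a (jet (b, j))) (order_zero p)"
      using fun_cong[OF act_zero_acts_commute[OF good_jet empty, of a p], of "order_zero p"]
      by (cases i) (simp_all add: acts_append del: act.simps(2,3))
    finally show "word_value (p @ [(a, i), (b, j)] @ q) = acts p (act i a (jet (b, j))) (order_zero p)" .
  qed
  also have "\<dots> = acts p (leib n (\<lambda>i j. act i a (jet (b, j)))) (order_zero p)"
    by (rule leib_additive[of "\<lambda>h. acts p h (order_zero p)", symmetric]) (simp add: acts_add)
  also have "\<dots> = acts p (jet (a \<odot> b, n)) (order_zero p)"
    by (simp only: leib_jet)
  also have "\<dots> = word_value (p @ [(a \<odot> b, n)] @ q)"
  \<comment> \<open>A single letter of order 0 is kept as it is, whereas the sum yields its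
    projection; the two agree because \<open>a \<odot> b\<close> lies in \<open>V\<close>.\<close>
  proof (cases "p = [] \<and> n = 0")
    case True
    then show ?thesis
      by (simp add: Nil word_value_single point_def proj_id mult_in_V)
  next
    case False
    then show ?thesis
      by (simp add: Nil word_value_snoc)
  qed
  finally show ?thesis .
next
  case (snoc q' z)
  let ?h = "acts p (acts q' (jet z))" and ?N = "order_zero p + order_zero q'"
  have good_q: "good (acts q' (jet z))"
    by (simp add: good_acts good_jet)
  then have h: "good ?h"
    by (rule good_acts)
  have "leib n (\<lambda>i j. word_value (p @ [(a, i), (b, j)] @ q)) =
      leib n (\<lambda>i j. act i a (act j b ?h) ?N)"
  proof (rule leib_cong)
    fix i j :: nat
    assume "0 < j"
    then obtain j' where j: "j = Suc j'" by (cases j) auto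
    have "word_value (p @ [(a, i), (b, j)] @ q) =
        acts p (acts [(a, i)] (act j b (acts q' (jet z)))) (order_zero (p @ [(a, i)] @ q'))"
      using word_value_snoc[of "p @ [(a, i), (b, j)] @ q'" z] j
      by (cases i) (simp_all add: snoc acts_append del: act.simps)
    also have "\<dots> = act i a (act j b ?h) ?N"
      by (cases i) (simp_all add: j act_acts_commute[OF good_q] act_acts_commute[OF good_act[OF good_q]]
          del: act.simps(2,3))
    finally show "word_value (p @ [(a, i), (b, j)] @ q) = act i a (act j b ?h) ?N" .
  qed
  also have "\<dots> = leib n (\<lambda>i j. act i a (act j b ?h)) ?N"
    by (rule leib_additive[of "\<lambda>h. h ?N", symmetric]) simp
  also have "\<dots> = act n (a \<odot> b) ?h ?N"
    by (simp only: act_mult[OF h])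
  also have "\<dots> = word_value (p @ [(a \<odot> b, n)] @ q)"
    using word_value_snoc[of "p @ [(a \<odot> b, n)] @ q'" z]
    by (cases n) (simp_all add: snoc acts_append act_acts_commute[OF good_q] del: act.simps(2,3))
  finally show ?thesis .
qed

end

section \<open>The free differential algebra and its quotient\<close>

text \<open>
  Words form a monoid under concatenation, so \<open>perm_carrier\<close> becomes the free associative
  unital algebra on the pairs (element, order of derivative).
\<close>
instantiation list :: (type) monoid_add
begin

definition zero_list :: "'a list" where "zero_list = []"
definition plus_list :: "'a list \<Rightarrow> 'a list \<Rightarrow> 'a list" where "plus_list = (@)"

instance
  by standard (simp_all add: zero_list_def plus_list_def)

end

lemma poly_mapping_induct_single:
  assumes "\<And>s c. P (Poly_Mapping.single s c)" and "\<And>x y. P x \<Longrightarrow> P y \<Longrightarrow> P (x + y)"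
  shows "P (x :: 'x \<Rightarrow>\<^sub>0 'b::comm_monoid_add)"
proof (induction x rule: update_induct)
  case const
  show ?case using assms(1)[of undefined 0] by simp
next
  case (update f a b)
  have "Poly_Mapping.update a b f = f + Poly_Mapping.single a b"
    using update(1)
    by (intro poly_mapping_eqI) (auto simp: lookup_update lookup_add lookup_single in_keys_iff when_def)
  then show ?case using update(3) assms by simp
qed

abbreviation const :: "'b \<Rightarrow> 'x list \<Rightarrow>\<^sub>0 'b::field" where
  "const \<equiv> Poly_Mapping.single []"

abbreviation word :: "'x list \<Rightarrow> 'x list \<Rightarrow>\<^sub>0 'b::field" where
  "word s \<equiv> Poly_Mapping.single s 1"

definition csmult :: "'b \<Rightarrow> ('x list \<Rightarrow>\<^sub>0 'b::field) \<Rightarrow> ('x list \<Rightarrow>\<^sub>0 'b)" where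
  "csmult c x = const c * x"

lemma single_times_single:
  "Poly_Mapping.single s a * Poly_Mapping.single t b = Poly_Mapping.single (s @ t) (a * b)"
  for a b :: "'b::semiring_0"
  by (simp add: mult_single plus_list_def)

lemma word_Nil: "word [] = 1"
  unfolding zero_list_def[symmetric] by (rule single_one)

lemma const_commute: "x * const c = const c * x"
  by (induction x rule: poly_mapping_induct_single)
    (simp_all add: single_times_single mult.commute distrib_left distrib_right)

lemma vector_space_csmult: "vector_space csmult"
  by standard (simp_all add: csmult_def distrib_left distrib_right single_add
      single_times_single word_Nil flip: mult.assoc)

global_interpretation free_algebra: vector_space csmult
  by (rule vector_space_csmult)

lemma csmult_mult: "csmult c x * y = csmult c (x * y)" "x * csmult c y = csmult c (x * y)"
  by (simp_all add: csmult_def mult.assoc flip: const_commute)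

lemma csmult_single: "csmult c (Poly_Mapping.single s b) = Poly_Mapping.single s (c * b)"
  by (simp add: csmult_def single_times_single)

lemma single_eq_csmult: "Poly_Mapping.single s b = csmult b (word s)"
  by (simp add: csmult_single)

definition extend :: "('b::field \<Rightarrow> 'v::ab_group_add \<Rightarrow> 'v) \<Rightarrow> ('x \<Rightarrow> 'v) \<Rightarrow> ('x \<Rightarrow>\<^sub>0 'b) \<Rightarrow> 'v" where
  "extend sc f x = (\<Sum>s\<in>Poly_Mapping.keys x. sc (Poly_Mapping.lookup x s) (f s))"

context vector_space
begin

lemma extend_superset:
  assumes "finite S" and "Poly_Mapping.keys x \<subseteq> S"
  shows "extend scale f x = (\<Sum>s\<in>S. scale (Poly_Mapping.lookup x s) (f s))"
  unfolding extend_def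
  by (rule sum.mono_neutral_left[OF assms]) (auto simp: in_keys_iff)

lemma extend_add: "extend scale f (x + y) = extend scale f x + extend scale f y"
proof -
  let ?S = "Poly_Mapping.keys x \<union> Poly_Mapping.keys y"
  have *: "extend scale f z = (\<Sum>s\<in>?S. scale (Poly_Mapping.lookup z s) (f s))"
    if "Poly_Mapping.keys z \<subseteq> ?S" for z
    using that by (intro extend_superset) simp_all
  show ?thesis
    using keys_add[of x y] by (simp add: * lookup_add scale_left_distrib sum.distrib)
qed

lemma extend_single: "extend scale f (Poly_Mapping.single s c) = scale c (f s)"
  by (simp add: extend_def)

lemma extend_csmult:
  fixes f :: "'x list \<Rightarrow> 'b"
  shows "extend scale f (csmult c x) = scale c (extend scale f x)"
  by (induction x rule: poly_mapping_induct_single)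
    (simp_all add: extend_single csmult_single extend_add free_algebra.scale_right_distrib
      scale_right_distrib)

end

section \<open>Derivation and augmentation of the free algebra\<close>

fun word_der :: "('x \<times> nat) list \<Rightarrow> ('x \<times> nat) list \<Rightarrow>\<^sub>0 'b::field" where
  "word_der [] = 0"
| "word_der ((a, n) # s) = word ((a, Suc n) # s) + word [(a, n)] * word_der s"

lemma word_der_append: "word_der (s @ t) = word_der s * word t + word s * word_der t"
  by (induction s rule: word_der.induct)
    (simp_all add: distrib_right distrib_left single_times_single word_Nil flip: mult.assoc)

definition fder :: "(('x \<times> nat) list \<Rightarrow>\<^sub>0 'b::field) \<Rightarrow> ('x \<times> nat) list \<Rightarrow>\<^sub>0 'b" where
  "fder = extend csmult word_der"

lemma fder_add: "fder (x + y) = fder x + fder y"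
  and fder_csmult: "fder (csmult c x) = csmult c (fder x)"
  and fder_word: "fder (word s) = word_der s"
  by (simp_all add: fder_def free_algebra.extend_add free_algebra.extend_csmult
      free_algebra.extend_single)

lemma fder_diff: "fder (x - y) = fder x - fder y"
  using fder_add[of "x - y" y] by simp

lemma fder_mult:
  fixes x y :: "('x \<times> nat) list \<Rightarrow>\<^sub>0 'b::field"
  shows "fder (x * y) = fder x * y + x * fder y"
proof (induction x rule: poly_mapping_induct_single)
  case (1 s c)
  show ?case
  proof (induction y rule: poly_mapping_induct_single)
    case (1 t d)
    let ?s = "word s :: ('x \<times> nat) list \<Rightarrow>\<^sub>0 'b" and ?t = "word t :: ('x \<times> nat) list \<Rightarrow>\<^sub>0 'b"
    have words: "fder (?s * ?t) = fder ?s * ?t + ?s * fder ?t"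
      by (simp add: single_times_single fder_word word_der_append)
    have "fder (csmult c ?s * csmult d ?t) =
        fder (csmult c ?s) * csmult d ?t + csmult c ?s * fder (csmult d ?t)"
      by (simp only: csmult_mult fder_csmult words free_algebra.scale_right_distrib)
    then show ?case
      by (simp only: single_eq_csmult[symmetric])
  next
    case (2 x y)
    then show ?case by (simp add: distrib_left fder_add)
  qed
next
  case (2 x y)
  then show ?case by (simp add: distrib_right fder_add)
qed

definition counit :: "('x list \<Rightarrow>\<^sub>0 'b::field) \<Rightarrow> 'b" where
  "counit x = Poly_Mapping.lookup x []"

lemma counit_add: "counit (x + y) = counit x + counit y"
  and counit_diff: "counit (x - y) = counit x - counit y"
  and counit_single: "counit (Poly_Mapping.single s c) = (if s = [] then c else 0)"
  by (simp_all add: counit_def lookup_add lookup_minus lookup_single when_def)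

lemma counit_mult: "counit (x * y) = counit x * counit y"
proof (induction x rule: poly_mapping_induct_single)
  case (1 s c)
  show ?case
    by (induction y rule: poly_mapping_induct_single)
      (simp_all add: distrib_left counit_add counit_single single_times_single)
next
  case (2 x y)
  then show ?case by (simp add: distrib_right counit_add)
qed

lemma counit_csmult: "counit (csmult c x) = c * counit x"
  by (simp add: csmult_def counit_mult counit_single)

lemma counit_fder:
  fixes x :: "('x \<times> nat) list \<Rightarrow>\<^sub>0 'b::field"
  shows "counit (fder x) = 0"
proof (induction x rule: poly_mapping_induct_single)
  case (1 s c)
  have "counit (word_der s :: ('x \<times> nat) list \<Rightarrow>\<^sub>0 'b) = 0"
    by (induction s rule: word_der.induct)
      (simp_all add: counit_add counit_mult counit_single, simp add: counit_def)
  then show ?case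
    by (simp add: single_eq_csmult[of s c] fder_csmult fder_word counit_csmult)
qed (simp add: fder_add counit_add)

text \<open>
  The Perm identity with \<open>z = 1\<close> would force commutativity, so constants are removed from both
  factors of the product.
\<close>
definition augment :: "('x list \<Rightarrow>\<^sub>0 'b::field) \<Rightarrow> 'x list \<Rightarrow>\<^sub>0 'b" where
  "augment x = x - const (counit x)"

lemma augment_add: "augment (x + y) = augment x + augment y"
  and augment_csmult: "augment (csmult c x) = csmult c (augment x)"
  and counit_augment: "counit (augment x) = 0"
  and augment_id: "counit x = 0 \<Longrightarrow> augment x = x"
  by (simp_all add: augment_def counit_add counit_csmult single_add counit_diff counit_single
      free_algebra.scale_right_diff_distrib csmult_single)

lemma fder_augment: "fder (augment x) = fder x"
  by (simp add: augment_def fder_diff single_eq_csmult[of "[]" "counit x"] fder_csmult fder_word)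

section \<open>The ideal of defining relations\<close>

locale word_evaluation = bilinear_algebra scale mult
  for scale :: "'k::field \<Rightarrow> 'a::ab_group_add \<Rightarrow> 'a" and mult (infixl "\<odot>" 70) +
  fixes W :: "('a \<times> nat) list \<Rightarrow> 'a"
  assumes W_single: "W [(b, 0)] = b"
    and W_swap: "\<And>p x y z q. W (p @ [x, y, z] @ q) = W (p @ [y, x, z] @ q)"
    and W_add: "\<And>p a b n q. W (p @ [(a + b, n)] @ q) = W (p @ [(a, n)] @ q) + W (p @ [(b, n)] @ q)"
    and W_scale: "\<And>p c a n q. W (p @ [(scale c a, n)] @ q) = scale c (W (p @ [(a, n)] @ q))"
    and W_mult: "\<And>p a b n q.
      leib n (\<lambda>i j. W (p @ [(a, i), (b, j)] @ q)) = W (p @ [(a \<odot> b, n)] @ q)"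
begin

text \<open>The relations are imposed at all orders at once, so that the derivative of each relator
  is again a sum of relators and the ideal is stable under \<open>fder\<close>.\<close>

inductive_set relators :: "(('a, 'k) perm_carrier) set" where
  perm: "word [x, y, z] - word [y, x, z] \<in> relators"
| add: "word [(a + b, n)] - word [(a, n)] - word [(b, n)] \<in> relators"
| scale: "word [(scale c a, n)] - csmult c (word [(a, n)]) \<in> relators"
| mult: "leib n (\<lambda>i j. word [(a, i), (b, j)]) - word [(a \<odot> b, n)] \<in> relators"

definition rel_ideal :: "(('a, 'k) perm_carrier) set" where
  "rel_ideal = free_algebra.span {word p * k * word q | p k q. k \<in> relators}"

lemma subspace_rel_ideal: "free_algebra.subspace rel_ideal"
  by (simp add: rel_ideal_def)

lemmas rel_ideal_simps = subspace_rel_ideal[THEN free_algebra.subspace_add]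
  subspace_rel_ideal[THEN free_algebra.subspace_diff]
  subspace_rel_ideal[THEN free_algebra.subspace_scale]
  subspace_rel_ideal[THEN free_algebra.subspace_0]

lemma rel_ideal_induct [consumes 1, case_names zero add scale base]:
  assumes "x \<in> rel_ideal"
    and "P 0" and "\<And>x y. P x \<Longrightarrow> P y \<Longrightarrow> P (x + y)" and "\<And>c x. P x \<Longrightarrow> P (csmult c x)"
    and "\<And>p k q. k \<in> relators \<Longrightarrow> P (word p * k * word q)"
  shows "P x"
proof -
  have "free_algebra.subspace {x. P x}"
    using assms(2-4) by (simp add: free_algebra.subspace_def)
  then show ?thesis
    using free_algebra.span_induct[OF assms(1)[unfolded rel_ideal_def], of P] assms(5) by blast
qed

lemma relator_in_ideal: "k \<in> relators \<Longrightarrow> word p * k * word q \<in> rel_ideal"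
  unfolding rel_ideal_def by (rule free_algebra.span_base) blast

lemma relators_subset: "k \<in> relators \<Longrightarrow> k \<in> rel_ideal"
  using relator_in_ideal[of k "[]" "[]"] by (simp add: word_Nil)

lemma rel_ideal_mult_left:
  assumes "x \<in> rel_ideal"
  shows "y * x \<in> rel_ideal"
proof (induction y rule: poly_mapping_induct_single)
  case (1 s c)
  have "word s * x \<in> rel_ideal"
    using assms
  proof (induction rule: rel_ideal_induct)
    case (base p k q)
    then show ?case
      using relator_in_ideal[of k "s @ p" q] by (simp add: single_times_single flip: mult.assoc)
  qed (simp_all add: rel_ideal_simps distrib_left csmult_mult)
  then show ?case
    by (simp add: single_eq_csmult[of s c] csmult_mult rel_ideal_simps)
qed (simp add: distrib_right rel_ideal_simps)

lemma rel_ideal_mult_right: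
  assumes "x \<in> rel_ideal"
  shows "x * y \<in> rel_ideal"
proof (induction y rule: poly_mapping_induct_single)
  case (1 s c)
  have "x * word s \<in> rel_ideal"
    using assms
  proof (induction rule: rel_ideal_induct)
    case (base p k q)
    then show ?case
      using relator_in_ideal[of k p "q @ s"] by (simp add: single_times_single mult.assoc)
  qed (simp_all add: rel_ideal_simps distrib_right csmult_mult)
  then show ?case
    by (simp add: single_eq_csmult[of s c] csmult_mult rel_ideal_simps)
qed (simp add: distrib_left rel_ideal_simps)

lemma fder_relators: "k \<in> relators \<Longrightarrow> fder k \<in> rel_ideal"
proof (induction rule: relators.induct)
  case (perm x y z)
  obtain a i b j c l where xyz: "x = (a, i)" "y = (b, j)" "z = (c, l)"
    by (cases x, cases y, cases z)
  let ?r = "\<lambda>x y z. word [x, y, z] - word [y, x, z] :: ('a, 'k) perm_carrier"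
  have "fder (?r x y z) = ?r (a, Suc i) y z + ?r x (b, Suc j) z + ?r x y (c, Suc l)"
    by (simp add: xyz fder_diff fder_word distrib_left single_times_single)
  moreover have "?r x y z \<in> rel_ideal" for x y z
    by (rule relators_subset) (rule relators.perm)
  ultimately show ?case
    by (simp add: rel_ideal_simps)
next
  case (add a b n)
  show ?case
    using relators_subset[OF relators.add[of a b "Suc n"]] by (simp add: fder_diff fder_word)
next
  case (scale c a n)
  show ?case
    using relators_subset[OF relators.scale[of c a "Suc n"]]
    by (simp add: fder_diff fder_word fder_csmult)
next
  case (mult n a b)
  have "fder (leib n (\<lambda>i j. word [(a, i), (b, j)]) :: ('a, 'k) perm_carrier) =
      leib n (\<lambda>i j. fder (word [(a, i), (b, j)]))"
    by (rule leib_additive) (rule fder_add)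
  also have "\<dots> = leib (Suc n) (\<lambda>i j. word [(a, i), (b, j)])"
    by (simp add: fder_word single_times_single)
  finally show ?case
    using relators_subset[OF relators.mult[of "Suc n" a b]] by (simp add: fder_diff fder_word)
qed

lemma fder_rel_ideal:
  assumes "x \<in> rel_ideal"
  shows "fder x \<in> rel_ideal"
  using assms
proof (induction rule: rel_ideal_induct)
  case zero
  then show ?case using fder_add[of 0 "0 :: ('a, 'k) perm_carrier"] by (simp add: rel_ideal_simps)
next
  case (base p k q)
  then show ?case
    by (simp add: fder_mult rel_ideal_simps fder_relators relators_subset rel_ideal_mult_left
        rel_ideal_mult_right)
qed (simp_all add: fder_add fder_csmult rel_ideal_simps)

lemma counit_rel_ideal:
  assumes "x \<in> rel_ideal"
  shows "counit x = 0"
  using assms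
proof (induction rule: rel_ideal_induct)
  case zero
  then show ?case by (simp add: counit_def)
next
  case (base p k q)
  have "counit (leib n (\<lambda>i j. word [(a, i), (b, j)]) :: ('a, 'k) perm_carrier) = 0" for n a b
    using leib_additive[of counit n "\<lambda>i j. word [(a, i), (b, j)] :: ('a, 'k) perm_carrier"]
    by (simp add: counit_add counit_single leib_zero)
  with base have "counit k = 0"
    by (cases rule: relators.cases) (simp_all add: counit_diff counit_single counit_csmult)
  then show ?case
    by (simp add: counit_mult)
qed (simp_all add: counit_add counit_csmult)

definition evaluate :: "('a, 'k) perm_carrier \<Rightarrow> 'a" where
  "evaluate = extend scale W"

lemma evaluate_add: "evaluate (x + y) = evaluate x + evaluate y"
  and evaluate_csmult: "evaluate (csmult c x) = scale c (evaluate x)"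
  and evaluate_word: "evaluate (word s) = W s"
  by (simp_all add: evaluate_def extend_add extend_csmult extend_single)

lemma evaluate_diff: "evaluate (x - y) = evaluate x - evaluate y"
  using evaluate_add[of "x - y" y] by (simp add: algebra_simps)

text \<open>Each law of \<open>W\<close> kills one family of relators. Hence \<open>evaluate\<close>
  descends to the quotient, where it is a left inverse of the embedding.\<close>

lemma evaluate_rel_ideal:
  assumes "x \<in> rel_ideal"
  shows "evaluate x = 0"
  using assms
proof (induction rule: rel_ideal_induct)
  case zero
  then show ?case using evaluate_add[of 0 0] by simp
next
  case (base p k q)
  from base show ?case
  proof (cases rule: relators.cases)
    case (perm x y z)
    then show ?thesis
      using W_swap[of p x y z q]
      by (simp add: left_diff_distrib right_diff_distrib single_times_single evaluate_diff evaluate_word)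
  next
    case (add a b n)
    then show ?thesis
      using W_add[of p a b n q]
      by (simp add: left_diff_distrib right_diff_distrib single_times_single evaluate_diff evaluate_word)
  next
    case (scale c a n)
    then show ?thesis
      using W_scale[of p c a n q]
      by (simp add: left_diff_distrib right_diff_distrib single_times_single csmult_mult
          evaluate_diff evaluate_word evaluate_csmult)
  next
    case (mult n a b)
    have "evaluate (word p * leib n (\<lambda>i j. word [(a, i), (b, j)]) * word q) =
        leib n (\<lambda>i j. evaluate (word p * word [(a, i), (b, j)] * word q))"
      by (rule leib_additive[of "\<lambda>x. evaluate (word p * x * word q)"])
        (simp add: distrib_left distrib_right evaluate_add)
    then show ?thesis
      using W_mult[of n p a b q] mult
      by (simp add: left_diff_distrib right_diff_distrib single_times_single evaluate_diff evaluate_word)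
  qed
qed (simp_all add: evaluate_add evaluate_csmult)

section \<open>The quotient as a differential Perm-algebra\<close>

lemma letter_commute_in_ideal:
  assumes "r \<noteq> []"
  shows "(word s * word [x] - word [x] * word s) * word r \<in> rel_ideal"
proof (induction s)
  case Nil
  then show ?case by (simp add: word_Nil rel_ideal_simps)
next
  case (Cons y s)
  \<comment> \<open>The Perm relator needs a third letter on the right, which exists because r is
    nonempty.\<close>
  obtain z q where zq: "s @ r = z # q"
    using assms by (cases "s @ r") auto
  have "word [] * (word [y, x, z] - word [x, y, z]) * word q \<in> rel_ideal"
    by (rule relator_in_ideal) (rule relators.perm)
  then have "word (y # x # s @ r) - word (x # y # s @ r) \<in> rel_ideal"
    by (simp add: left_diff_distrib single_times_single word_Nil zq)
  moreover have "word [y] * ((word s * word [x] - word [x] * word s) * word r) \<in> rel_ideal"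
    using Cons by (rule rel_ideal_mult_left)
  ultimately have "(word (y # x # s @ r) - word (x # y # s @ r)) +
      word [y] * ((word s * word [x] - word [x] * word s) * word r) \<in> rel_ideal"
    by (rule rel_ideal_simps)
  then show ?case
    by (simp add: left_diff_distrib right_diff_distrib single_times_single)
qed

lemma word_commute_in_ideal:
  assumes "r \<noteq> []"
  shows "(word s * word t - word t * word s) * word r \<in> rel_ideal"
proof (induction t)
  case Nil
  then show ?case by (simp add: word_Nil rel_ideal_simps)
next
  case (Cons x t)
  have "(word s * word [x] - word [x] * word s) * word (t @ r) \<in> rel_ideal"
    using assms by (intro letter_commute_in_ideal) simp
  moreover have "word [x] * ((word s * word t - word t * word s) * word r) \<in> rel_ideal"
    using Cons by (rule rel_ideal_mult_left)
  ultimately have "(word s * word [x] - word [x] * word s) * word (t @ r) +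
      word [x] * ((word s * word t - word t * word s) * word r) \<in> rel_ideal"
    by (rule rel_ideal_simps)
  then show ?case
    by (simp add: left_diff_distrib right_diff_distrib single_times_single)
qed

lemma commute_in_ideal: "(x * y - y * x) * augment z \<in> rel_ideal"
proof (induction z rule: poly_mapping_induct_single)
  case (1 r c)
  show ?case
  proof (cases "r = []")
    case True
    then show ?thesis by (simp add: augment_def counit_single rel_ideal_simps)
  next
    case False
    have "(x * y - y * x) * word r \<in> rel_ideal"
    proof (induction x rule: poly_mapping_induct_single)
      case (1 s a)
      show ?case
      proof (induction y rule: poly_mapping_induct_single)
        case (1 t b)
        have "csmult b (csmult a ((word s * word t - word t * word s) * word r)) \<in> rel_ideal"
          by (intro rel_ideal_simps word_commute_in_ideal False)
        then have "(csmult a (word s) * csmult b (word t) - csmult b (word t) * csmult a (word s)) * word r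
            \<in> rel_ideal"
          by (simp only: csmult_mult free_algebra.scale_right_diff_distrib left_diff_distrib
              free_algebra.scale_left_commute[of a b])
        then show ?case
          by (simp only: single_eq_csmult[symmetric])
      next
        case (2 y y')
        from rel_ideal_simps(1)[OF this] show ?case
          by (simp add: distrib_left distrib_right left_diff_distrib algebra_simps)
      qed
    next
      case (2 x x')
      from rel_ideal_simps(1)[OF this] show ?case
        by (simp add: distrib_left distrib_right left_diff_distrib algebra_simps)
    qed
    then show ?thesis
      by (simp add: augment_id counit_single False single_eq_csmult[of r c] csmult_mult
          augment_csmult rel_ideal_simps)
  qed
next
  case (2 z z')
  then show ?case by (simp add: augment_add distrib_left rel_ideal_simps)
qed

text \<open>The quotient is realized on the carrier itself: e is the projection along
  \<open>rel_ideal\<close> onto a linear complement, and the operations are those of the free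
  algebra, with constants removed from the factors, followed by e.\<close>

lemma embeds:
  "embeds_in_differential_perm_algebra TYPE(('a, 'k) perm_carrier) scale mult"
proof -
  interpret vs: vector_space_pair csmult csmult
    by (simp add: vector_space_pair_def vector_space_csmult)
  obtain g :: "('a, 'k) perm_carrier \<Rightarrow> ('a, 'k) perm_carrier" where
    g: "Vector_Spaces.linear csmult csmult g" "\<And>x. g x \<in> rel_ideal" "\<And>x. x \<in> rel_ideal \<Longrightarrow> g x = x"
    using vs.linear_exists_left_inverse_on[OF free_algebra.linear_id subspace_rel_ideal]
    by (auto simp: image_subset_iff)
  define e where "e x = x - g x" for x
  have e_add: "e (x + y) = e x + e y" and e_csmult: "e (csmult c x) = csmult c (e x)" for x y c
    using g(1) by (simp_all add: e_def Vector_Spaces.linear_iff free_algebra.scale_right_diff_distrib)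
  have e_diff: "e (x - y) = e x - e y" for x y
    using e_add[of "x - y" y] by simp
  have e_cong: "x - y \<in> rel_ideal \<Longrightarrow> e x = e y" for x y
    using e_diff[of x y] by (simp add: e_def g(3))
  have e_rel: "e x - x \<in> rel_ideal" for x
    using rel_ideal_simps(3)[OF g(2)[of x], of "-1"] by (simp add: e_def)
  have e_mult: "e (e x * y) = e (x * y)" "e (y * e x) = e (y * x)" for x y
    using rel_ideal_mult_right[OF e_rel[of x], of y] rel_ideal_mult_left[OF e_rel[of x], of y]
    by (auto intro!: e_cong simp: left_diff_distrib right_diff_distrib)
  have e_fder: "e (fder (e x)) = e (fder x)" for x
    using fder_rel_ideal[OF e_rel[of x]] by (auto intro!: e_cong simp: fder_diff)
  have counit_e: "counit (e x) = counit x" for x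
    using counit_rel_ideal[OF e_rel[of x]] by (simp add: counit_diff)
  have augment_e: "counit x = 0 \<Longrightarrow> augment (e x) = e x" for x
    by (simp add: augment_id counit_e)
  define mulP where "mulP x y = e (augment x * augment y)" for x y
  define dP where "dP x = e (fder x)" for x
  define \<theta> where "\<theta> a = e (word [(a, 0)])" for a
  have assoc: "mulP (mulP x y) z = e (augment x * augment y * augment z)"
      "mulP z (mulP x y) = e (augment z * augment x * augment y)" for x y z
    by (simp_all add: mulP_def augment_e counit_mult counit_augment e_mult mult.assoc)
  have "differential_perm_algebra csmult mulP dP"
  proof (intro differential_perm_algebra.intro perm_algebra.intro bilinear_algebra.intro
      vector_space_csmult bilinear_algebra_axioms.intro perm_algebra_axioms.intro
      differential_perm_algebra_axioms.intro)
    fix x y z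
    show "mulP (mulP x y) z = mulP x (mulP y z)"
      by (simp add: assoc)
    show "mulP (mulP x y) z = mulP (mulP y x) z"
      using commute_in_ideal[of "augment x" "augment y" z]
      by (auto simp: assoc left_diff_distrib intro!: e_cong)
    \<comment> \<open>Derivatives have no constant term and \<open>fder\<close> kills constants, so
      \<open>augment\<close> does not disturb the Leibniz rule.\<close>
    show "dP (mulP x y) = mulP (dP x) y + mulP x (dP y)"
      by (simp add: mulP_def dP_def e_fder fder_mult fder_augment e_add augment_e counit_fder e_mult)
    show "Vector_Spaces.linear csmult csmult (\<lambda>a. mulP a y)"
      and "Vector_Spaces.linear csmult csmult (mulP x)"
      and "Vector_Spaces.linear csmult csmult dP"
      by (simp_all add: Vector_Spaces.linear_iff vector_space_csmult mulP_def dP_def augment_add augment_csmult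
          distrib_left distrib_right e_add e_csmult csmult_mult fder_add fder_csmult)
  qed
  moreover have "is_differential_embedding scale mult csmult mulP dP \<theta>"
    unfolding is_differential_embedding_def
  proof (intro conjI allI)
    have "\<theta> (a + b) = \<theta> a + \<theta> b" for a b
      unfolding \<theta>_def e_add[symmetric]
      using relators_subset[OF relators.add[of a b 0]] by (intro e_cong) (simp add: algebra_simps)
    moreover have "\<theta> (scale c a) = csmult c (\<theta> a)" for c a
      unfolding \<theta>_def e_csmult[symmetric]
      using relators_subset[OF relators.scale[of c a 0]] by (intro e_cong)
    ultimately show "Vector_Spaces.linear scale csmult \<theta>"
      by (simp add: Vector_Spaces.linear_iff vector_space_csmult vector_space_axioms)
    show "inj \<theta>"
    proof (rule injI)
      fix a b
      assume "\<theta> a = \<theta> b"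
      moreover have "evaluate (\<theta> c) = c" for c
        using evaluate_rel_ideal[OF e_rel[of "word [(c, 0)]"]]
        by (simp add: \<theta>_def evaluate_diff evaluate_word W_single)
      ultimately show "a = b" by metis
    qed
    fix a b
    have "mulP (\<theta> a) (dP (\<theta> b)) = e (word [(a, 0)] * fder (word [(b, 0)]))"
      by (simp add: mulP_def dP_def \<theta>_def augment_e counit_single counit_fder e_fder e_mult)
    also have "\<dots> = e (word [(a, 0), (b, 1)])"
      by (simp add: fder_word single_times_single)
    also have "\<dots> = \<theta> (a \<odot> b)"
      unfolding \<theta>_def using relators_subset[OF relators.mult[of 0 a b]] by (intro e_cong) simp
    finally show "\<theta> (a \<odot> b) = mulP (\<theta> a) (dP (\<theta> b))" ..
  qed
  ultimately show ?thesis
    unfolding embeds_in_differential_perm_algebra_def by blast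
qed

end

section \<open>The embedding criterion\<close>

context nice_SLS_algebra
begin

text \<open>On the span of products \<open>mu x\<close> is determined by its values on products, so
  linearity in x, commutation and \<open>mult_mu\<close> need only be checked there. Precomposing
  with a linear projection onto the span makes the maps total.\<close>

lemma right_action_exists: "\<exists>rho proj. right_action scale mult product_space rho proj"
proof -
  interpret vs: vector_space_pair scale scale
    by (simp add: vector_space_pair_def vector_space_axioms)
  obtain proj where proj: "Vector_Spaces.linear scale scale proj" "\<And>v. proj v \<in> product_space"
    "\<And>v. v \<in> product_space \<Longrightarrow> proj v = v"
    using vs.linear_exists_left_inverse_on[OF linear_id subspace_product_space]
    by (auto simp: image_subset_iff)
  obtain mu where
    mu_add: "\<And>x u v. u \<in> product_space \<Longrightarrow> v \<in> product_space \<Longrightarrow> mu x (u + v) = mu x u + mu x v"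
    and mu_scale: "\<And>x c u. u \<in> product_space \<Longrightarrow> mu x (scale c u) = scale c (mu x u)"
    and mu_product: "\<And>x a b. mu x (a \<odot> b) = (a \<odot> x) \<odot> b"
    using nice unfolding nice_def by metis
  have mu_0: "mu x 0 = 0" for x
    using mu_add[of 0 0 x] by (simp add: product_space_simps)
  have mu_in: "mu x u \<in> product_space" if "u \<in> product_space" for x u
    using that
    by (induction rule: product_space_induct)
      (simp_all add: mu_0 mu_add mu_scale mu_product product_in_space product_space_simps)
  have mu_add_left: "mu (x + y) u = mu x u + mu y u" if "u \<in> product_space" for x y u
    using that
    by (induction rule: product_space_induct)
      (simp_all add: mu_0 mu_add mu_scale mu_product linear_right_simps linear_left_simps
        scale_right_distrib)
  have mu_scale_left: "mu (scale c x) u = scale c (mu x u)" if "u \<in> product_space" for c x u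
    using that
    by (induction rule: product_space_induct)
      (simp_all add: mu_0 mu_add mu_scale mu_product linear_right_simps linear_left_simps
        scale_right_distrib mult.commute)
  have mu_commute: "mu x (mu y u) = mu y (mu x u)" if "u \<in> product_space" for x y u
    using that
    by (induction rule: product_space_induct)
      (simp_all add: mu_0 mu_add mu_scale mu_product mu_in right_commutative_left)
  have mult_mu: "x \<odot> mu y u = mu y (x \<odot> u) + mu (x \<odot> y) u - mu y (mu x u)"
    if "u \<in> product_space" for x y u
    using that
  proof (induction rule: product_space_induct)
    case (product a b)
    \<comment> \<open>Additive combination of the three identities that follow: left-symmetry for x,
      a, y multiplied by b; left-symmetry for \<open>x \<odot> y\<close>, a, b after right
      commutativity; and the exchange identity for associators.\<close>
    have group: "r = s + p1 - p3" if "p4 - p2 = p3 - p1" "p4 - s = p1 - q" "p2 - r = p1 - q"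
      for p1 p2 p3 p4 q r s :: 'a
    proof -
      have "r = p2 - (p2 - r)"
        by simp
      also have "\<dots> = p2 - (p4 - s)"
        by (simp only: that(2,3))
      also have "\<dots> = s - (p4 - p2)"
        by (simp add: algebra_simps)
      also have "\<dots> = s + p1 - p3"
        by (simp only: that(1)) (simp add: algebra_simps)
      finally show ?thesis .
    qed
    have 1: "((x \<odot> a) \<odot> y) \<odot> b - (x \<odot> (a \<odot> y)) \<odot> b = ((a \<odot> x) \<odot> y) \<odot> b - (a \<odot> (x \<odot> y)) \<odot> b"
      using arg_cong[OF left_symmetric[of x a y], of "\<lambda>v. v \<odot> b"]
      by (simp add: associator_def linear_left_simps)
    have 2: "((x \<odot> a) \<odot> y) \<odot> b - (x \<odot> y) \<odot> (a \<odot> b) =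
        (a \<odot> (x \<odot> y)) \<odot> b - a \<odot> ((x \<odot> y) \<odot> b)"
      using left_symmetric[of "x \<odot> y" a b] right_commutative_left[of x y a b]
      by (simp only: associator_def)
    have 3: "(x \<odot> (a \<odot> y)) \<odot> b - x \<odot> ((a \<odot> y) \<odot> b) =
        (a \<odot> (x \<odot> y)) \<odot> b - a \<odot> ((x \<odot> y) \<odot> b)"
      using associator_exchange[of x a y b] by (simp only: associator_def)
    show ?case
      using group[OF 1 2 3] by (simp only: mu_product)
  qed (simp_all add: mu_0 mu_add mu_scale mu_in product_in_space linear_right_simps
      scale_right_distrib scale_right_diff_distrib)
  have "right_action scale mult product_space (\<lambda>x v. mu x (proj v)) proj"
    by (intro right_action.intro left_symmetric_algebra_axioms right_action_axioms.intro)
      (use proj(1) in \<open>simp_all add: Vector_Spaces.linear_iff subspace_product_space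
        product_in_space mu_in mu_add mu_scale mu_product mu_add_left mu_scale_left proj
        mu_commute mult_mu\<close>)
  then show ?thesis by blast
qed

lemma embeds_in_perm_carrier:
  "embeds_in_differential_perm_algebra TYPE(('a, 'k) perm_carrier) scale mult"
proof -
  obtain rho proj where "right_action scale mult product_space rho proj"
    using right_action_exists by blast
  then interpret right_action scale mult product_space rho proj .
  interpret word_evaluation scale mult word_value
  proof
    fix p x y z q
    show "word_value (p @ [x, y, z] @ q) = word_value (p @ [y, x, z] @ q)"
      \<comment> \<open>The third letter and the arbitrary tail form a nonempty list, split here at
        its last letter.\<close>
      using word_value_swap[of p x y "butlast (z # q)" "last (z # q)"]
      by (simp del: butlast.simps last.simps)
  qed (rule word_value_single word_value_add word_value_scale word_value_mult)+
  show ?thesis by (rule embeds)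
qed

end

text \<open>The SLS identities are verified in the Perm-algebra, where left multiplications commute,
  and pulled back along the injective map.\<close>

lemma embedding_imp_nice_SLS_algebra:
  fixes scale :: "'k::field \<Rightarrow> 'a::ab_group_add \<Rightarrow> 'a" and mult :: "'a \<Rightarrow> 'a \<Rightarrow> 'a"
  assumes "left_symmetric_algebra scale mult"
    and "embeds_in_differential_perm_algebra TYPE('p::ab_group_add) scale mult"
  shows "nice_SLS_algebra scale mult"
proof -
  obtain scaleP :: "'k \<Rightarrow> 'p \<Rightarrow> 'p" and multP d \<theta> where
    "differential_perm_algebra scaleP multP d"
    and embedding: "is_differential_embedding scale mult scaleP multP d \<theta>"
    using assms(2) unfolding embeds_in_differential_perm_algebra_def by blast
  interpret A: left_symmetric_algebra scale mult by fact
  interpret P: differential_perm_algebra scaleP multP d by fact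
  interpret \<theta>: Vector_Spaces.linear scale scaleP \<theta>
    using embedding by (simp add: is_differential_embedding_def)
  interpret d: Vector_Spaces.linear scaleP scaleP d
    by (rule P.linear_derivation)
  have inj: "\<theta> a = \<theta> b \<Longrightarrow> a = b" and prod: "\<theta> (mult a b) = multP (\<theta> a) (d (\<theta> b))" for a b
    using embedding by (auto simp: is_differential_embedding_def inj_def)
  note simps = prod A.associator_def \<theta>.diff P.leibniz P.associative P.linear_right_simps
    P.linear_left_simps
  have commute: "multP x (multP y z) = multP y (multP x z)" for x y z
    using P.perm[of x y z] by (simp only: P.associative)
  have right_commutative: "mult (mult (mult x y) z) u = mult (mult (mult x z) y) u" for x y z u
    by (rule inj) (simp add: simps commute[of "d (\<theta> y)"])
  have exchange: "A.associator x (mult y z) u = A.associator y (mult x z) u" for x y z u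
    by (rule inj) (simp add: simps commute[of "\<theta> x" "\<theta> y"])
  have "\<exists>\<mu>. (\<forall>u\<in>A.product_space. \<forall>v\<in>A.product_space. \<mu> (u + v) = \<mu> u + \<mu> v) \<and>
      (\<forall>c. \<forall>u\<in>A.product_space. \<mu> (scale c u) = scale c (\<mu> u)) \<and>
      (\<forall>a b. \<mu> (mult a b) = mult (mult a x) b)" for x
  proof -
    \<comment> \<open>Multiplication by d(\<theta>(x)), pulled back along \<theta>. The inverse is
      meaningful only on the image of \<theta>; for u in the span of products the argument lies
      there, because for u = \<open>mult a b\<close> it is the image of
      \<open>mult (mult a x) b\<close>.\<close>
    define \<mu> where "\<mu> u = inv \<theta> (multP (d (\<theta> x)) (\<theta> u))" for u
    have \<mu>_eq: "\<mu> u = v" if "\<theta> v = multP (d (\<theta> x)) (\<theta> u)" for u v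
      using that inj unfolding \<mu>_def by (metis inv_f_f injI)
    have \<mu>_prod: "\<mu> (mult a b) = mult (mult a x) b" for a b
      by (rule \<mu>_eq) (simp add: prod P.associative commute[of "\<theta> a"])
    have \<theta>_\<mu>: "\<theta> (\<mu> u) = multP (d (\<theta> x)) (\<theta> u)" if "u \<in> A.product_space" for u
    proof -
      have "\<exists>v. \<theta> v = multP (d (\<theta> x)) (\<theta> u)"
        using that
      proof (induction rule: A.product_space_induct)
        case zero
        show ?case by (rule exI[of _ 0]) (simp add: \<theta>.zero P.linear_right_simps)
      next
        case (add u v)
        then show ?case by (metis \<theta>.add P.linear_right_simps(1))
      next
        case (scale c u)
        then show ?case by (metis \<theta>.scale P.linear_right_simps(4))
      next
        case (product a b)
        show ?case
          by (rule exI[of _ "mult (mult a x) b"]) (simp add: prod P.associative commute[of "\<theta> a"])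
      qed
      then show ?thesis using \<mu>_eq by metis
    qed
    have "\<mu> (u + v) = \<mu> u + \<mu> v" if "u \<in> A.product_space" "v \<in> A.product_space" for u v
      using that by (intro \<mu>_eq) (simp add: \<theta>.add \<theta>_\<mu> P.linear_right_simps)
    moreover have "\<mu> (scale c u) = scale c (\<mu> u)" if "u \<in> A.product_space" for c u
      using that by (intro \<mu>_eq) (simp add: \<theta>.scale \<theta>_\<mu> P.linear_right_simps)
    ultimately show ?thesis
      using \<mu>_prod by blast
  qed
  then have "A.nice"
    by (simp add: A.nice_def)
  then show ?thesis
    using right_commutative exchange by unfold_locales
qed

theorem theorem3:
  fixes scale :: "'k::field \<Rightarrow> 'a::ab_group_add \<Rightarrow> 'a"
    and mult :: "'a \<Rightarrow> 'a \<Rightarrow> 'a"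
  assumes "left_symmetric_algebra scale mult"
  shows "(embeds_in_differential_perm_algebra TYPE(('a, 'k) perm_carrier) scale mult
            \<longleftrightarrow> nice_SLS_algebra scale mult)
       \<and> (embeds_in_differential_perm_algebra TYPE('p::ab_group_add) scale mult
            \<longrightarrow> nice_SLS_algebra scale mult)"
proof (intro conjI iffI impI)
  assume "nice_SLS_algebra scale mult"
  then show "embeds_in_differential_perm_algebra TYPE(('a, 'k) perm_carrier) scale mult"
    by (rule nice_SLS_algebra.embeds_in_perm_carrier)
qed (rule embedding_imp_nice_SLS_algebra[OF assms], assumption)+

end
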